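(* Let $\Omega\subset\mathbb R^n$ be a bounded domain, let $\mathbf p=(p_1,\dots,p_n)$ satisfy $1<p_1\le\dots\le p_n<\infty$ and let $\mathbf s=(s_1,\dots,s_n)$ with $0<s_i<1$. Assume $\bar{\mathbf p}<n$, $\overline{\mathbf s\mathbf p}<n$ and $p_n<\mathbf p^*_{\mathbf s}$. Let $u\in W^{\mathbf s,\mathbf p}_0(\Omega)$, $u\ne0$. Then $u$ is a critical point of $\mathcal Q_{\mathbf s,\mathbf p}$ if and only if, for some $\lambda\in\mathbb R$, $u$ is a weak solution of $$-\mathcal L_{\mathbf s,\mathbf p}u=\lambda\,\mathcal F_{\mathbf p}(u)\ \text{ in }\Omega,\qquad u=0\ \text{ in }\mathbb R^n\setminus\Omega.$$
   Context: Harmonic mean and products: for vectors with positive entries, $\bar{\mathbf q}=\left(\frac1n\sum_{i=1}^n\frac1{q_i}\right)^{-1}$ and $\mathbf s\mathbf p=(s_1p_1,\dots,s_np_n)$. Fractional critical exponent: $\mathbf p^*_{\mathbf s}=\dfrac{n\,\overline{\mathbf s\mathbf p}/\bar{\mathbf s}}{n-\overline{\mathbf s\mathbf p}}$. Mixed Lebesgue norm: for measurable $u:\mathbb R^n\to\mathbb R$ put $I_1(u)=\left(\int_{\mathbb R}|u|^{p_1}dx_1\right)^{1/p_1}$, $I_j(u)=\left(\int_{\mathbb R}I_{j-1}(u)^{p_j}dx_j\right)^{1/p_j}$ for $j=2,\dots,n$ (a function of $(x_{j+1},\dots,x_n)$), and $\|u\|_{\mathbf p}=I_n(u)$. $L^{\mathbf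 p}(\mathbb R^n)$ is the space of measurable $u$ with $\|u\|_{\mathbf p}<\infty$. With $e_i$ the $i$-th canonical basis vector, $[u]_{s,p,i}=\left(\int_{\mathbb R^n}\int_{\mathbb R}\frac{|u(x+he_i)-u(x)|^p}{|h|^{1+sp}}\,dh\,dx\right)^{1/p}$ and $[u]_{\mathbf s,\mathbf p}=\sum_{i=1}^n[u]_{s_i,p_i,i}$. $W^{\mathbf s,\mathbf p}(\mathbb R^n)=\{u\in L^{\mathbf p}(\mathbb R^n):[u]_{s_i,p_i,i}<\infty,\ i=1,\dots,n\}$ with norm $\|u\|_{\mathbf p}+[u]_{\mathbf s,\mathbf p}$; $W^{\mathbf s,\mathbf p}_0(\Omega)$ is the closure of $C_c^\infty(\Omega)$ in it. $\mathcal Q_{\mathbf s,\mathbf p}(u)=[u]_{\mathbf s,\mathbf p}/\|u\|_{\mathbf p}$ for $u\in W^{\mathbf s,\mathbf p}_0(\Omega)\setminus\{0\}$; $u\ne0$ is a critical point if $\frac{d}{dt}\mathcal Q_{\mathbf s,\mathbf p}(u+tv)|_{t=0}=0$ for all $v\in W^{\mathbf s,\mathbf p}_0(\Omega)$. $\mathcal F_{\mathbf p}(u)=\prod_{i=1}^n I_i(u)^{p_{i+1}-p_i}|u|^{p_1-2}u$ with $p_{n+1}=1$ (understood as $0$ where $u=0$). Put $D^{s,i}_hu(x)=\frac{u(x+he_i)-u(x)}{|h|^s}$. The operator $-\mathcal L_{\mathbf s,\mathbf p}$ is understood weakly: $u$ is a weak solution of the problem with parameter $\lambda$ if $$\sum_{i=1}^n\int_{\mathbb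 R^n}\int_{\mathbb R}\left|\frac{D^{s_i,i}_hu(x)}{[u]_{s_i,p_i,i}}\right|^{p_i-2}\frac{D^{s_i,i}_hu(x)}{[u]_{s_i,p_i,i}}\,D^{s_i,i}_hv(x)\,\frac{dh}{|h|}\,dx=\lambda\int_{\mathbb R^n}\mathcal F_{\mathbf p}(u)v\,dx\quad\text{for all }v\in W^{\mathbf s,\mathbf p}_0(\Omega).$$ *)

theory Defs
  imports "HOL-Analysis.Analysis"
begin

text \<open>
  Points of \<open>\<real>\<^sup>n\<close> are vectors \<open>real ^ 'n\<close> (abbreviated \<open>'n rn\<close>) over a finite, linearly
  ordered index type.  The order matters because the mixed norm integrates out the variables one
  after another; \<open>coord k\<close> is the \<open>k\<close>-th index for \<open>k = 1, \<dots>, CARD('n)\<close>.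
\<close>

type_synonym 'n rn = "(real, 'n) vec"

definition coord :: "nat \<Rightarrow> 'n::{finite,linorder}" where
  "coord k = sorted_list_of_set UNIV ! (k - 1)"

definition hmean :: "'n::finite rn \<Rightarrow> real" where
  "hmean q = inverse ((1 / real CARD('n)) * (\<Sum>i\<in>UNIV. 1 / (q $ i)))"

text \<open>The product \<open>s * p\<close> of vectors is componentwise.\<close>

definition crit_exp :: "'n::finite rn \<Rightarrow> 'n rn \<Rightarrow> real" where
  "crit_exp s p =
     real CARD('n) * (hmean (s * p) / hmean s) / (real CARD('n) - hmean (s * p))"

text \<open>Powers of extended nonnegative reals; used for exponents \<open>a > 0\<close> only.\<close>

definition epowr :: "ennreal \<Rightarrow> real \<Rightarrow> ennreal" where
  "epowr x a = (if x = \<infinity> then \<infinity> else ennreal (enn2real x powr a))"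

text \<open>
  \<open>mixed_I p u k\<close> is \<open>I\<^sub>k(u)\<close>, kept as a function of the whole point \<open>x\<close> although its value does
  not depend on the first \<open>k\<close> coordinates; \<open>I\<^sub>0(u) = \<bar>u\<bar>\<close>.
\<close>

primrec mixed_I ::
  "'n::{finite,linorder} rn \<Rightarrow> ('n rn \<Rightarrow> real) \<Rightarrow> nat \<Rightarrow> 'n rn \<Rightarrow> ennreal" where
  "mixed_I p u 0 = (\<lambda>x. ennreal \<bar>u x\<bar>)"
| "mixed_I p u (Suc k) = (\<lambda>x.
     epowr (\<integral>\<^sup>+ t. epowr (mixed_I p u k (\<chi> j. if j = coord (Suc k) then t else x $ j))
                        (p $ coord (Suc k)) \<partial>lborel)
           (1 / (p $ coord (Suc k))))"

text \<open>\<open>I\<^sub>n(u)\<close> is constant, so the point of evaluation is irrelevant.\<close>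

definition mixed_norm :: "'n::{finite,linorder} rn \<Rightarrow> ('n rn \<Rightarrow> real) \<Rightarrow> ennreal" where
  "mixed_norm p u = mixed_I p u CARD('n) 0"

text \<open>
  Elements of the function spaces are represented by Borel functions; two functions that agree
  almost everywhere represent the same element.
\<close>

definition mixed_L :: "'n::{finite,linorder} rn \<Rightarrow> ('n rn \<Rightarrow> real) set" where
  "mixed_L p = {u \<in> borel_measurable lborel. mixed_norm p u < \<infinity>}"

definition gagliardo :: "real \<Rightarrow> real \<Rightarrow> 'n::finite \<Rightarrow> ('n rn \<Rightarrow> real) \<Rightarrow> ennreal" where
  "gagliardo s p i u =
     epowr (\<integral>\<^sup>+ x. \<integral>\<^sup>+ h. ennreal (\<bar>u (x + h *\<^sub>R axis i 1) - u x\<bar> powr p / \<bar>h\<bar> powr (1 + s * p))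
              \<partial>lborel \<partial>lborel)
           (1 / p)"

definition gagliardo_sum :: "'n::finite rn \<Rightarrow> 'n rn \<Rightarrow> ('n rn \<Rightarrow> real) \<Rightarrow> ennreal" where
  "gagliardo_sum s p u = (\<Sum>i\<in>UNIV. gagliardo (s $ i) (p $ i) i u)"

definition W_space ::
  "'n::{finite,linorder} rn \<Rightarrow> 'n rn \<Rightarrow> ('n rn \<Rightarrow> real) set" where
  "W_space s p = {u \<in> mixed_L p. \<forall>i. gagliardo (s $ i) (p $ i) i u < \<infinity>}"

definition W_norm ::
  "'n::{finite,linorder} rn \<Rightarrow> 'n rn \<Rightarrow> ('n rn \<Rightarrow> real) \<Rightarrow> ennreal" where
  "W_norm s p u = mixed_norm p u + gagliardo_sum s p u"

primrec C_k :: "nat \<Rightarrow> ('n::finite rn \<Rightarrow> real) \<Rightarrow> bool" where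
  "C_k 0 f = continuous_on UNIV f"
| "C_k (Suc k) f =
     ((\<forall>x. f differentiable (at x)) \<and>
      (\<forall>i. C_k k (\<lambda>x. frechet_derivative f (at x) (axis i 1))))"

definition Cc_infinity :: "('n::finite rn) set \<Rightarrow> ('n rn \<Rightarrow> real) set" where
  "Cc_infinity \<Omega> =
     {f. (\<forall>k. C_k k f) \<and> compact (closure {x. f x \<noteq> 0}) \<and> closure {x. f x \<noteq> 0} \<subseteq> \<Omega>}"

definition W0_space ::
  "('n::{finite,linorder} rn) set \<Rightarrow> 'n rn \<Rightarrow> 'n rn \<Rightarrow> ('n rn \<Rightarrow> real) set" where
  "W0_space \<Omega> s p =
     {u \<in> W_space s p.
        \<forall>e>0. \<exists>f\<in>Cc_infinity \<Omega>. W_norm s p (\<lambda>x. u x - f x) < ennreal e}"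

definition quotient_Q ::
  "'n::{finite,linorder} rn \<Rightarrow> 'n rn \<Rightarrow> ('n rn \<Rightarrow> real) \<Rightarrow> real" where
  "quotient_Q s p u = enn2real (gagliardo_sum s p u) / enn2real (mixed_norm p u)"

text \<open>\<open>u \<noteq> 0\<close> means that \<open>u\<close> does not vanish almost everywhere.\<close>

definition critical_point ::
  "('n::{finite,linorder} rn) set \<Rightarrow> 'n rn \<Rightarrow> 'n rn \<Rightarrow> ('n rn \<Rightarrow> real) \<Rightarrow> bool" where
  "critical_point \<Omega> s p u \<longleftrightarrow>
     u \<in> W0_space \<Omega> s p \<and> \<not> (AE x in lborel. u x = 0) \<and>
     (\<forall>v\<in>W0_space \<Omega> s p.
        ((\<lambda>t. quotient_Q s p (\<lambda>x. u x + t * v x)) has_real_derivative 0) (at 0))"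

text \<open>The exponents \<open>p\<^sub>1, \<dots>, p\<^sub>n\<close>, extended by \<open>p\<^sub>n\<^sub>+\<^sub>1 = 1\<close>.\<close>

definition ext_exp :: "'n::{finite,linorder} rn \<Rightarrow> nat \<Rightarrow> real" where
  "ext_exp p k = (if k \<le> CARD('n) then p $ coord k else 1)"

text \<open>
  For \<open>u \<in> L\<^sup>p\<close> with \<open>u \<noteq> 0\<close>, the set of points where \<open>u x \<noteq> 0\<close> but some factor \<open>I\<^sub>i(u)\<close> is \<open>0\<close> or
  \<open>\<infinity>\<close> is a null set, so the conventions for these values play no role.
\<close>

definition F_op ::
  "'n::{finite,linorder} rn \<Rightarrow> ('n rn \<Rightarrow> real) \<Rightarrow> 'n rn \<Rightarrow> real" where
  "F_op p u x =
     (if u x = 0 then 0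
      else (\<Prod>i=1..CARD('n). enn2real (mixed_I p u i x) powr (ext_exp p (i + 1) - ext_exp p i))
           * \<bar>u x\<bar> powr (ext_exp p 1 - 2) * u x)"

definition diff_quot :: "real \<Rightarrow> 'n::finite \<Rightarrow> real \<Rightarrow> ('n rn \<Rightarrow> real) \<Rightarrow> 'n rn \<Rightarrow> real" where
  "diff_quot s i h u x = (u (x + h *\<^sub>R axis i 1) - u x) / \<bar>h\<bar> powr s"

text \<open>The condition \<open>u = 0\<close> outside \<open>\<Omega>\<close> is encoded, as usual, by \<open>u \<in> W0_space \<Omega> s p\<close>.\<close>

definition weak_solution ::
  "('n::{finite,linorder} rn) set \<Rightarrow> 'n rn \<Rightarrow> 'n rn \<Rightarrow> real \<Rightarrow> ('n rn \<Rightarrow> real) \<Rightarrow> bool"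
where
  "weak_solution \<Omega> s p c u \<longleftrightarrow>
     u \<in> W0_space \<Omega> s p \<and>
     (\<forall>v\<in>W0_space \<Omega> s p.
        (\<Sum>i\<in>UNIV.
           LINT x|lborel. LINT h|lborel.
             (let d = diff_quot (s $ i) i h u x / enn2real (gagliardo (s $ i) (p $ i) i u)
              in \<bar>d\<bar> powr (p $ i - 2) * d * diff_quot (s $ i) i h v x / \<bar>h\<bar>))
        = c * (LINT x|lborel. F_op p u x * v x))"

end

theory Submission
  imports Defs
begin

text \<open>
  Write \<open>S(v)\<close> for \<open>[v]\<^bsub>s,p\<^esub>\<close> and \<open>M(v)\<close> for \<open>\<parallel>v\<parallel>\<^sub>p\<close>.  Both are positive at \<open>u\<close>, and both are
  differentiable at \<open>u\<close> in every direction \<open>v\<close>: the derivative \<open>S'(v)\<close> is the left-hand side of the weak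
  equation (\<open>gagliardo_has_derivative\<close>), and \<open>M'(v) = \<integral> \<F>\<^sub>p(u) v\<close> (\<open>mixed_norm_has_derivative\<close> with
  \<open>integral_F_op\<close>).  By the quotient rule \<open>u\<close> is critical if and only if \<open>S'(v) M(u) = S(u) M'(v)\<close> for all
  \<open>v\<close>, which is the weak equation with \<open>\<lambda> = S(u) / M(u)\<close>.  No other \<open>\<lambda>\<close> can occur: \<open>S\<close> and \<open>M\<close> are
  homogeneous, so \<open>S'(u) = S(u)\<close> and \<open>M'(u) = M(u)\<close>, and testing a weak equation with \<open>v = u\<close> yields
  \<open>S(u) = \<lambda> M(u)\<close>.

  Both derivatives come from one lemma on \<open>L\<^sup>p\<close> norms, \<open>Lp_norm_has_derivative\<close>.  A Gagliardo seminorm is an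
  \<open>L\<^sup>p\<close> norm on \<open>\<real>\<^sup>n \<times> \<real>\<close>.  The mixed norm is an iterated \<open>L\<^sup>p\<close> norm, and the lemma is applied once for
  each variable; its conclusion is again of the form of its hypotheses.  Unwinding the \<open>n\<close> nested
  derivative formulas by Fubini, the factor \<open>I\<^sub>k(u)\<close> enters with the power \<open>1 - p\<^sub>k\<close> from the outer root of
  step \<open>k\<close> and with \<open>p\<^sub>k\<^sub>+\<^sub>1 - 1\<close> from the inner power of step \<open>k + 1\<close>.  Together they make the
  power \<open>p\<^sub>k\<^sub>+\<^sub>1 - p\<^sub>k\<close> in the definition of \<open>\<F>\<^sub>p(u)\<close>.

  Functions of the last \<open>n - k\<close> variables are treated as functions on all of \<open>\<real>\<^sup>n\<close> that ignore the first \<open>k\<close>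
  coordinates.  Null sets then always refer to Lebesgue measure on \<open>\<real>\<^sup>n\<close> (\<open>AE_slice_iff\<close>), and an integral over
  fewer variables is an integral over \<open>\<real>\<^sup>n\<close> weighted by the unit cube in the ignored coordinates.
\<close>


section \<open>Powers of extended nonnegative reals\<close>

lemma epowr_ennreal: "0 \<le> r \<Longrightarrow> epowr (ennreal r) a = ennreal (r powr a)"
  by (simp add: epowr_def)

lemma epowr_top [simp]: "epowr top a = top"
  by (simp add: epowr_def)

lemma epowr_0 [simp]: "epowr 0 a = 0"
  by (simp add: epowr_def)

lemma epowr_one [simp]: "epowr x 1 = x"
  by (cases x) (simp_all add: epowr_ennreal)

lemma epowr_eq_0_iff [simp]: "epowr x a = 0 \<longleftrightarrow> x = 0"
  by (cases x) (auto simp: epowr_ennreal ennreal_eq_0_iff top_unique)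

lemma epowr_eq_top_iff [simp]: "epowr x a = top \<longleftrightarrow> x = top"
  by (cases x) (auto simp: epowr_ennreal)

lemma epowr_less_top_iff [simp]: "epowr x a < top \<longleftrightarrow> x < top"
  by (metis epowr_eq_top_iff less_top)

lemma epowr_mono: "0 \<le> a \<Longrightarrow> x \<le> y \<Longrightarrow> epowr x a \<le> epowr y a"
  by (cases x; cases y) (auto simp: epowr_ennreal top_unique intro!: ennreal_leI powr_mono2)

lemma epowr_mult: "epowr (x * y) a = epowr x a * epowr y a"
proof (cases "x = 0 \<or> y = 0")
  case False
  then show ?thesis
    by (cases x; cases y)
       (auto simp: epowr_ennreal ennreal_mult[symmetric] powr_mult ennreal_top_mult ennreal_mult_top)
qed auto

lemma epowr_epowr: "epowr (epowr x a) b = epowr x (a * b)"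
  by (cases x) (auto simp: epowr_ennreal powr_powr)

lemma epowr_add: "epowr x (a + b) = epowr x a * epowr x b"
  by (cases x) (auto simp: epowr_ennreal powr_add ennreal_mult[symmetric])

lemma measurable_epowr [measurable]:
  assumes [measurable]: "f \<in> borel_measurable M"
  shows "(\<lambda>x. epowr (f x) a) \<in> borel_measurable M"
  unfolding epowr_def infinity_ennreal_def by measurable

section \<open>The inequalities of Hoelder and Minkowski\<close>

text \<open>
  The \<open>L\<^sup>p\<close> norm is taken of \<open>[0,\<infinity>]\<close>-valued functions and with value in \<open>[0,\<infinity>]\<close>.  One step of the
  mixed norm is then literally such a norm on a line, and Hoelder and Minkowski hold on every single
  line, with no exceptional null sets to carry through the iteration.
\<close>

definition Lp_norm :: "'a measure \<Rightarrow> real \<Rightarrow> ('a \<Rightarrow> ennreal) \<Rightarrow> ennreal" where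
  "Lp_norm M p f = epowr (\<integral>\<^sup>+ x. epowr (f x) p \<partial>M) (1 / p)"

lemma epowr_Lp_norm: "p \<noteq> 0 \<Longrightarrow> epowr (Lp_norm M p f) p = (\<integral>\<^sup>+ x. epowr (f x) p \<partial>M)"
  by (simp add: Lp_norm_def epowr_epowr)

lemma Lp_norm_mono:
  "0 < p \<Longrightarrow> (\<And>x. f x \<le> g x) \<Longrightarrow> Lp_norm M p f \<le> Lp_norm M p g"
  unfolding Lp_norm_def by (auto intro!: epowr_mono nn_integral_mono)

lemma Lp_norm_cong_AE:
  "AE x in M. f x = g x \<Longrightarrow> Lp_norm M p f = Lp_norm M p g"
  unfolding Lp_norm_def by (auto intro!: arg_cong[where f = "\<lambda>y. epowr y _"] nn_integral_cong_AE)

lemma Lp_norm_mono_AE: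
  "0 < p \<Longrightarrow> AE x in M. f x \<le> g x \<Longrightarrow> Lp_norm M p f \<le> Lp_norm M p g"
  unfolding Lp_norm_def by (auto intro!: epowr_mono nn_integral_mono_AE)

lemma Lp_norm_cmult:
  assumes "p \<noteq> 0" and [measurable]: "f \<in> borel_measurable M"
  shows "Lp_norm M p (\<lambda>x. c * f x) = c * Lp_norm M p f"
  using assms by (simp add: Lp_norm_def epowr_mult nn_integral_cmult epowr_epowr)

lemma Lp_norm_eq_0_AE:
  assumes [measurable]: "f \<in> borel_measurable M" and "Lp_norm M p f = 0"
  shows "AE x in M. f x = 0"
  using assms(2) by (simp add: Lp_norm_def nn_integral_0_iff_AE)

lemma Lp_norm_finite_AE:
  assumes [measurable]: "f \<in> borel_measurable M" and "Lp_norm M p f < top"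
  shows "AE x in M. f x < top"
proof -
  have "AE x in M. epowr (f x) p \<noteq> \<infinity>"
    using assms(2) by (intro nn_integral_PInf_AE) (auto simp: Lp_norm_def)
  then show ?thesis by (auto simp: less_top)
qed

lemma young_powr:
  fixes r s p :: real
  assumes "1 < p" "0 \<le> r" "0 \<le> s"
  shows "r powr (p - 1) * s \<le> (1 - 1 / p) * r powr p + (1 / p) * s powr p"
proof -
  have "r powr (p - 1) * s \<le> (r powr (p - 1)) powr (p / (p - 1)) / (p / (p - 1)) + s powr p / p"
    using assms by (intro Youngs_inequality) (auto simp: field_simps)
  also have "(r powr (p - 1)) powr (p / (p - 1)) = r powr p"
    using assms(1) by (simp add: powr_powr)
  finally show ?thesis using assms(1) by (simp add: diff_divide_distrib algebra_simps)
qed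

text \<open>
  The exponent conjugate to \<open>p\<close> is hidden by writing the first factor as \<open>f\<^sup>p\<^sup>-\<^sup>1\<close>, the form in which the
  inequality meets derivatives of \<open>p\<close>-th powers.  If both norms are finite and positive, Young's
  inequality for \<open>f / \<parallel>f\<parallel>\<close> and \<open>g / \<parallel>g\<parallel>\<close> is integrated; the other cases are degenerate.
\<close>

theorem Holder_Lp_norm:
  assumes p: "1 < p" and [measurable]: "f \<in> borel_measurable M" "g \<in> borel_measurable M"
  shows "(\<integral>\<^sup>+ x. epowr (f x) (p - 1) * g x \<partial>M) \<le> epowr (Lp_norm M p f) (p - 1) * Lp_norm M p g"
proof (cases "Lp_norm M p f = 0 \<or> Lp_norm M p g = 0")
  case True
  then have "AE x in M. epowr (f x) (p - 1) * g x = 0"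
    using Lp_norm_eq_0_AE[of f M p] Lp_norm_eq_0_AE[of g M p] by auto
  then have "(\<integral>\<^sup>+ x. epowr (f x) (p - 1) * g x \<partial>M) = 0"
    by (subst nn_integral_0_iff_AE) auto
  then show ?thesis by simp
next
  case nz: False
  show ?thesis
  proof (cases "Lp_norm M p f = top \<or> Lp_norm M p g = top")
    case True
    with nz show ?thesis by (auto simp: ennreal_top_mult ennreal_mult_top)
  next
    case False
    with nz obtain a b where a: "Lp_norm M p f = ennreal a" "a > 0" and b: "Lp_norm M p g = ennreal b" "b > 0"
      by (metis ennreal_cases ennreal_eq_0_iff not_le)
    have fp: "(\<integral>\<^sup>+ x. epowr (f x) p \<partial>M) = ennreal (a powr p)"
      and gp: "(\<integral>\<^sup>+ x. epowr (g x) p \<partial>M) = ennreal (b powr p)"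
      using epowr_Lp_norm[of p M f] epowr_Lp_norm[of p M g] p a b by (simp_all add: epowr_ennreal)
    \<comment> \<open>the coefficients of Young's inequality for \<open>f / a\<close> and \<open>g / b\<close> after multiplication by \<open>a\<^sup>p\<^sup>-\<^sup>1 b\<close>\<close>
    let ?A = "(1 - 1 / p) * b / a" and ?B = "(1 / p) * a powr (p - 1) / b powr (p - 1)"
    have A: "?A > 0" and B: "?B > 0" using p a b by (auto simp: field_simps)
    have scale: "P * b * (c * (R / (P * a)) + e * (S / (Q * b))) = (c * b / a) * R + (e * P / Q) * S"
      if "P > 0" "Q > 0" for P Q c e R S :: real
      using a b that by (simp add: field_simps)
    have young: "epowr (f x) (p - 1) * g x \<le> ennreal ?A * epowr (f x) p + ennreal ?B * epowr (g x) p" for x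
    proof (cases "f x = top \<or> g x = top")
      case True
      then show ?thesis using A B by (auto simp: ennreal_mult_top)
    next
      case False
      then obtain r s where r: "f x = ennreal r" "r \<ge> 0" and s: "g x = ennreal s" "s \<ge> 0"
        by (metis ennreal_cases)
      have "(r / a) powr (p - 1) * (s / b) \<le> (1 - 1 / p) * (r / a) powr p + (1 / p) * (s / b) powr p"
        using young_powr[of p "r / a" "s / b"] p a b r s by simp
      then have "a powr (p - 1) * b * ((r / a) powr (p - 1) * (s / b))
          \<le> a powr (p - 1) * b * ((1 - 1 / p) * (r / a) powr p + (1 / p) * (s / b) powr p)"
        using a b by (intro mult_left_mono) auto
      also have "a powr (p - 1) * b * ((r / a) powr (p - 1) * (s / b)) = r powr (p - 1) * s"
        using a b r s by (simp add: powr_divide)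
      also have "a powr (p - 1) * b * ((1 - 1 / p) * (r / a) powr p + (1 / p) * (s / b) powr p)
          = ?A * r powr p + ?B * s powr p"
      proof -
        have "a powr p = a powr (p - 1) * a" "b powr p = b powr (p - 1) * b"
          using a b powr_mult_base[of a "p - 1"] powr_mult_base[of b "p - 1"] by (simp_all add: mult.commute)
        then show ?thesis using a b r s scale[of "a powr (p - 1)" "b powr (p - 1)"]
          by (simp only: powr_divide less_imp_le powr_gt_zero)
      qed
      finally show ?thesis
        unfolding r(1) s(1) epowr_ennreal[OF r(2)] epowr_ennreal[OF s(2)]
        using ennreal_leI less_imp_le[OF A] less_imp_le[OF B] r(2) s(2)
        by (simp only: ennreal_mult[symmetric] ennreal_plus[symmetric] powr_ge_zero mult_nonneg_nonneg)
    qed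
    have "(\<integral>\<^sup>+ x. epowr (f x) (p - 1) * g x \<partial>M) \<le>
       (\<integral>\<^sup>+ x. ennreal ?A * epowr (f x) p + ennreal ?B * epowr (g x) p \<partial>M)"
      by (intro nn_integral_mono young)
    also have "\<dots> = ennreal ?A * ennreal (a powr p) + ennreal ?B * ennreal (b powr p)"
      by (simp add: nn_integral_add nn_integral_cmult fp gp)
    also have "\<dots> = ennreal (?A * a powr p + ?B * b powr p)"
      using less_imp_le[OF A] less_imp_le[OF B]
      by (simp only: ennreal_mult[symmetric] ennreal_plus[symmetric] powr_ge_zero mult_nonneg_nonneg)
    also have "?A * a powr p + ?B * b powr p = a powr (p - 1) * b"
    proof -
      have "a powr p = a powr (p - 1) * a" "b powr p = b powr (p - 1) * b"
        using a b powr_mult_base[of a "p - 1"] powr_mult_base[of b "p - 1"] by (simp_all add: mult.commute)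
      have scale': "(c * b / a) * (P * a) + (e * P / Q) * (Q * b) = (c + e) * (P * b)"
        if "P > 0" "Q > 0" for P Q c e :: real
        using a b that by (simp add: field_simps)
      have "?A * (a powr (p - 1) * a) + ?B * (b powr (p - 1) * b) = a powr (p - 1) * b"
        using scale'[of "a powr (p - 1)" "b powr (p - 1)" "1 - 1 / p" "1 / p"] a b
        by (simp only: powr_gt_zero) simp
      with \<open>a powr p = a powr (p - 1) * a\<close> \<open>b powr p = b powr (p - 1) * b\<close> show ?thesis by (simp only:)
    qed
    also have "ennreal (a powr (p - 1) * b) = epowr (Lp_norm M p f) (p - 1) * Lp_norm M p g"
      using a b by (simp add: epowr_ennreal ennreal_mult)
    finally show ?thesis .
  qed
qed

lemma epowr_add_le:
  assumes "0 \<le> p"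
  shows "epowr (x + y) p \<le> ennreal (2 powr p) * (epowr x p + epowr y p)"
proof -
  have "x + y \<le> max x y + max x y" by (intro add_mono) auto
  then have "epowr (x + y) p \<le> epowr (ennreal 2 * max x y) p"
    using assms by (intro epowr_mono) (simp_all add: mult_2)
  also have "\<dots> = ennreal (2 powr p) * epowr (max x y) p"
    by (simp only: epowr_mult epowr_ennreal[of 2 p] zero_le_numeral)
  also have "\<dots> \<le> ennreal (2 powr p) * (epowr x p + epowr y p)"
    by (intro mult_left_mono) (auto simp: max_def)
  finally show ?thesis .
qed

text \<open>
  With \<open>S\<close> the norm of \<open>f + g\<close>, Hoelder applied to both terms of
  \<open>(f + g)\<^sup>p = (f + g)\<^sup>p\<^sup>-\<^sup>1 f + (f + g)\<^sup>p\<^sup>-\<^sup>1 g\<close> gives \<open>S\<^sup>p \<le> S\<^sup>p\<^sup>-\<^sup>1 (\<parallel>f\<parallel> + \<parallel>g\<parallel>)\<close>.  Dividing by \<open>S\<^sup>p\<^sup>-\<^sup>1\<close> needs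
  \<open>S < \<infinity>\<close>, which the crude bound \<open>epowr_add_le\<close> provides.
\<close>

theorem Minkowski_Lp_norm:
  assumes p: "1 < p" and [measurable]: "f \<in> borel_measurable M" "g \<in> borel_measurable M"
  shows "Lp_norm M p (\<lambda>x. f x + g x) \<le> Lp_norm M p f + Lp_norm M p g" (is "?S \<le> ?F + ?G")
proof (cases "?F = top \<or> ?G = top \<or> ?S = 0")
  case False
  have "(\<integral>\<^sup>+ x. epowr (f x + g x) p \<partial>M) \<le>
     (\<integral>\<^sup>+ x. ennreal (2 powr p) * (epowr (f x) p + epowr (g x) p) \<partial>M)"
    using p by (intro nn_integral_mono epowr_add_le) auto
  also have "\<dots> = ennreal (2 powr p) * ((\<integral>\<^sup>+ x. epowr (f x) p \<partial>M) + (\<integral>\<^sup>+ x. epowr (g x) p \<partial>M))"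
    by (simp add: nn_integral_cmult nn_integral_add)
  also have "\<dots> < top"
    using False by (simp add: Lp_norm_def ennreal_mult_less_top less_top)
  finally have "?S \<noteq> top" by (simp add: Lp_norm_def)
  with False obtain c where c: "?S = ennreal c" "c > 0"
    by (metis ennreal_cases ennreal_eq_0_iff not_le)
  have "ennreal (c powr (p - 1)) * ?S = epowr ?S (p - 1) * epowr ?S 1"
    using c by (simp add: epowr_ennreal)
  also have "\<dots> = (\<integral>\<^sup>+ x. epowr (f x + g x) p \<partial>M)"
    using p by (simp only: epowr_add[symmetric]) (simp add: epowr_Lp_norm)
  also have "\<dots> = (\<integral>\<^sup>+ x. epowr (f x + g x) (p - 1) * f x + epowr (f x + g x) (p - 1) * g x \<partial>M)"
    using epowr_add[of _ "p - 1" 1] by (simp add: distrib_left)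
  also have "\<dots> \<le> epowr ?S (p - 1) * ?F + epowr ?S (p - 1) * ?G"
    by (subst nn_integral_add) (auto intro!: add_mono Holder_Lp_norm p)
  also have "\<dots> = ennreal (c powr (p - 1)) * (?F + ?G)"
    using c by (simp add: epowr_ennreal distrib_left)
  finally show ?thesis
    using c by (simp add: ennreal_mult_le_mult_iff)
qed auto

section \<open>Derivatives of \<open>L\<^sup>p\<close> norms\<close>

text \<open>
  The mean value theorem; zero is split off because the derivative of \<open>powr\<close> is available at positive
  arguments only.
\<close>

lemma abs_powr_diff_le:
  fixes x y p :: real
  assumes "1 \<le> p" "0 \<le> x" "0 \<le> y"
  shows "\<bar>x powr p - y powr p\<bar> \<le> p * (x + y) powr (p - 1) * \<bar>x - y\<bar>"
proof -
  have *: "\<bar>x powr p - y powr p\<bar> \<le> p * (x + y) powr (p - 1) * \<bar>x - y\<bar>" if "0 \<le> y" "y < x" for x y :: real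
  proof (cases "y = 0")
    case True
    have "x powr p = x powr (p - 1) * x"
      using that powr_mult_base[of x "p - 1"] by (simp add: mult.commute)
    moreover have "1 * (x powr (p - 1) * x) \<le> p * (x powr (p - 1) * x)"
      using assms(1) that by (intro mult_right_mono) auto
    ultimately show ?thesis using True that by simp
  next
    case False
    with that have "0 < y" by simp
    have "\<exists>z>y. z < x \<and> x powr p - y powr p = (x - y) * (p * z powr (p - 1))"
      using \<open>0 < y\<close> \<open>y < x\<close> by (intro MVT2 has_real_derivative_powr) auto
    then obtain z where z: "y < z" "z < x" "x powr p - y powr p = (x - y) * (p * z powr (p - 1))"
      by blast
    have "z powr (p - 1) \<le> (x + y) powr (p - 1)"
      using z \<open>0 < y\<close> assms(1) by (intro powr_mono2) auto
    then have "(x - y) * (p * z powr (p - 1)) \<le> (x - y) * (p * (x + y) powr (p - 1))"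
      using that assms(1) by (intro mult_left_mono) auto
    moreover have "0 \<le> x powr p - y powr p"
      using that assms(1) by (simp add: powr_mono2)
    ultimately show ?thesis using z that by (simp add: mult_ac)
  qed
  show ?thesis
    using *[of x y] *[of y x] assms by (cases x y rule: linorder_cases) (auto simp: abs_minus_commute add.commute)
qed

lemma integrable_powr_iff:
  assumes [measurable]: "f \<in> borel_measurable M" and "\<And>x. 0 \<le> f x"
  shows "integrable M (\<lambda>x. f x powr p) \<longleftrightarrow> Lp_norm M p (\<lambda>x. ennreal (f x)) < top"
  using assms(2) by (simp add: integrable_iff_bounded Lp_norm_def epowr_ennreal infinity_ennreal_def)

lemma enn2real_Lp_norm:
  assumes [measurable]: "f \<in> borel_measurable M" and "\<And>x. 0 \<le> f x"
    and "Lp_norm M p (\<lambda>x. ennreal (f x)) < top"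
  shows "enn2real (Lp_norm M p (\<lambda>x. ennreal (f x))) = (\<integral>x. f x powr p \<partial>M) powr (1 / p)"
proof -
  have "(\<integral>\<^sup>+ x. epowr (ennreal (f x)) p \<partial>M) = ennreal (\<integral>x. f x powr p \<partial>M)"
    using assms by (simp add: epowr_ennreal nn_integral_eq_integral integrable_powr_iff)
  then show ?thesis by (simp add: Lp_norm_def epowr_ennreal integral_nonneg_AE)
qed

text \<open>
  Differentiation of an \<open>L\<^sup>p\<close> norm along a curve \<open>t \<mapsto> f t\<close> of nonnegative functions.  The hypotheses are
  what remains true after the norm has been taken in some of the variables: the curve is Lipschitz
  at \<open>0\<close> with an \<open>L\<^sup>p\<close> constant \<open>g\<close> (by Minkowski), but a derivative is available only where \<open>f 0\<close> is
  not zero, as \<open>\<bar>u + t v\<bar>\<close> has a corner where \<open>u\<close> is zero.  Where \<open>f 0 = 0\<close>, \<open>f t \<le> \<bar>t\<bar> g\<close>, so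
  \<open>(f t)\<^sup>p / t\<close> tends to \<open>0\<close> because \<open>p > 1\<close>.  Elsewhere the chain rule applies, and the difference
  quotients of \<open>(f t)\<^sup>p\<close> are dominated by \<open>p (2 f 0 + g)\<^sup>p\<close> for \<open>\<bar>t\<bar> < 1\<close>.
\<close>

theorem Lp_norm_has_derivative:
  fixes f :: "real \<Rightarrow> 'a \<Rightarrow> real" and p :: real
  assumes p: "1 < p"
    and meas [measurable]: "\<And>t. f t \<in> borel_measurable M" "g \<in> borel_measurable M" "d \<in> borel_measurable M"
    and nonneg: "\<And>t x. 0 \<le> f t x" "\<And>x. 0 \<le> g x"
    and lip: "AE x in M. \<forall>t. \<bar>f t x - f 0 x\<bar> \<le> \<bar>t\<bar> * g x"
    and deriv: "AE x in M. f 0 x \<noteq> 0 \<longrightarrow> ((\<lambda>t. f t x) has_real_derivative d x) (at 0)"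
    and fin: "Lp_norm M p (\<lambda>x. ennreal (f 0 x)) < top" "Lp_norm M p (\<lambda>x. ennreal (g x)) < top"
    and nz: "Lp_norm M p (\<lambda>x. ennreal (f 0 x)) \<noteq> 0"
  shows "((\<lambda>t. enn2real (Lp_norm M p (\<lambda>x. ennreal (f t x)))) has_real_derivative
      (\<integral>x. f 0 x powr (p - 1) * d x \<partial>M) / enn2real (Lp_norm M p (\<lambda>x. ennreal (f 0 x))) powr (p - 1)) (at 0)"
proof -
  have fin_comb: "Lp_norm M p (\<lambda>x. ennreal (a * f 0 x + b * g x)) < top" if "0 \<le> a" "0 \<le> b" for a b
  proof -
    have "Lp_norm M p (\<lambda>x. ennreal (a * f 0 x + b * g x))
        = Lp_norm M p (\<lambda>x. ennreal a * ennreal (f 0 x) + ennreal b * ennreal (g x))"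
      using that nonneg by (simp add: ennreal_mult)
    also have "\<dots> \<le> Lp_norm M p (\<lambda>x. ennreal a * ennreal (f 0 x)) + Lp_norm M p (\<lambda>x. ennreal b * ennreal (g x))"
      by (intro Minkowski_Lp_norm p) auto
    also have "\<dots> < top"
      using fin p by (simp add: Lp_norm_cmult ennreal_mult_less_top)
    finally show ?thesis .
  qed
  have fint: "Lp_norm M p (\<lambda>x. ennreal (f t x)) < top" for t
  proof -
    have "Lp_norm M p (\<lambda>x. ennreal (f t x)) \<le> Lp_norm M p (\<lambda>x. ennreal (1 * f 0 x + \<bar>t\<bar> * g x))"
    proof (rule Lp_norm_mono_AE)
      show "AE x in M. ennreal (f t x) \<le> ennreal (1 * f 0 x + \<bar>t\<bar> * g x)"
        using lip
      proof eventually_elim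
        case (elim x)
        from spec[OF elim, of t] show ?case by (intro ennreal_leI) linarith
      qed
    qed (use p in simp)
    also have "\<dots> < top" by (intro fin_comb) auto
    finally show ?thesis .
  qed
  define A where "A t = (\<integral>x. f t x powr p \<partial>M)" for t
  have N: "enn2real (Lp_norm M p (\<lambda>x. ennreal (f t x))) = A t powr (1 / p)" for t
    unfolding A_def using fint nonneg by (intro enn2real_Lp_norm) auto
  have int: "integrable M (\<lambda>x. f t x powr p)" for t
    using fint nonneg by (simp add: integrable_powr_iff)
  have "A 0 powr (1 / p) \<noteq> 0"
    using nz fin(1) N[of 0] by (auto simp: enn2real_eq_0_iff)
  moreover have "0 \<le> A 0" unfolding A_def by (intro integral_nonneg_AE) auto
  ultimately have A0: "0 < A 0" by auto
  have "((\<lambda>h. (A h - A 0) / h) \<longlongrightarrow> (\<integral>x. p * f 0 x powr (p - 1) * d x \<partial>M)) (at 0)"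
  proof (subst tendsto_at_iff_sequentially, intro allI impI)
    fix X :: "nat \<Rightarrow> real"
    assume X: "\<forall>i. X i \<in> UNIV - {0}" and X0: "X \<longlonglongrightarrow> 0"
    from X0 have "\<forall>\<^sub>F n in sequentially. \<bar>X n\<bar> < 1"
      using tendstoD[of X 0 sequentially 1] by simp
    then obtain n0 where n0: "\<And>n. n \<ge> n0 \<Longrightarrow> \<bar>X n\<bar> < 1" by (auto simp: eventually_sequentially)
    \<comment> \<open>the integrable bound needs \<open>\<bar>t\<bar> < 1\<close>, so a tail of the sequence is used\<close>
    let ?Y = "\<lambda>n. X (n + n0)"
    have Y: "?Y \<longlonglongrightarrow> 0" "\<And>n. ?Y n \<noteq> 0" "\<And>n. \<bar>?Y n\<bar> < 1"
      using X X0 n0 by (auto intro: LIMSEQ_ignore_initial_segment)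
    have "(\<lambda>n. \<integral>x. (f (?Y n) x powr p - f 0 x powr p) / ?Y n \<partial>M) \<longlonglongrightarrow> (\<integral>x. p * f 0 x powr (p - 1) * d x \<partial>M)"
    proof (rule integral_dominated_convergence[where w = "\<lambda>x. p * (2 * f 0 x + 1 * g x) powr p"])
      show "integrable M (\<lambda>x. p * (2 * f 0 x + 1 * g x) powr p)"
        using fin_comb[of 2 1] nonneg by (intro integrable_mult_right) (subst integrable_powr_iff; auto)
      show "AE x in M. norm ((f (?Y n) x powr p - f 0 x powr p) / ?Y n) \<le> p * (2 * f 0 x + 1 * g x) powr p" for n
        using lip
      proof eventually_elim
        case (elim x)
        then have l: "\<bar>f (?Y n) x - f 0 x\<bar> \<le> \<bar>?Y n\<bar> * g x" by blast
        have "\<bar>?Y n\<bar> * g x \<le> 1 * g x" using Y(3)[of n] nonneg by (intro mult_right_mono) auto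
        then have le: "f (?Y n) x + f 0 x \<le> 2 * f 0 x + g x" using l by linarith
        have "\<bar>f (?Y n) x powr p - f 0 x powr p\<bar> \<le> p * (f (?Y n) x + f 0 x) powr (p - 1) * \<bar>f (?Y n) x - f 0 x\<bar>"
          using p nonneg by (intro abs_powr_diff_le) auto
        also have "\<dots> \<le> p * (2 * f 0 x + g x) powr (p - 1) * (\<bar>?Y n\<bar> * (2 * f 0 x + g x))"
        proof (intro mult_mono powr_mono2 order_refl)
          show "\<bar>f (?Y n) x - f 0 x\<bar> \<le> \<bar>?Y n\<bar> * (2 * f 0 x + g x)"
            using l nonneg(1)[of 0 x] by (intro order_trans[OF l] mult_left_mono) auto
        qed (use p nonneg le in \<open>auto intro!: add_nonneg_nonneg mult_nonneg_nonneg\<close>)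
        also have "\<dots> = \<bar>?Y n\<bar> * (p * (2 * f 0 x + g x) powr p)"
          using powr_mult_base[of "2 * f 0 x + g x" "p - 1"] nonneg(1)[of 0 x] nonneg(2)[of x] by (simp add: mult_ac)
        finally show ?case using Y(2)[of n] by (simp add: divide_le_eq mult_ac)
      qed
      show "AE x in M. (\<lambda>n. (f (?Y n) x powr p - f 0 x powr p) / ?Y n) \<longlonglongrightarrow> p * f 0 x powr (p - 1) * d x"
        using lip deriv
      proof eventually_elim
        case (elim x)
        show ?case
        proof (cases "f 0 x = 0")
          case False
          then have "((\<lambda>t. f t x powr p) has_real_derivative p * f 0 x powr (p - of_nat 1) * d x) (at 0)"
            using elim nonneg(1)[of 0 x] by (intro DERIV_fun_powr) auto
          then have "((\<lambda>h. (f h x powr p - f 0 x powr p) / h) \<longlongrightarrow> p * f 0 x powr (p - 1) * d x) (at 0)"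
            by (simp add: has_field_derivative_iff)
          then show ?thesis
            using Y unfolding tendsto_at_iff_sequentially comp_def by auto
        next
          case True
          have "(\<lambda>n. \<bar>?Y n\<bar> powr (p - 1) * g x powr p) \<longlonglongrightarrow> \<bar>0\<bar> powr (p - 1) * g x powr p"
            using p Y(1) by (intro tendsto_mult tendsto_powr' tendsto_rabs tendsto_const) auto
          then have lim: "(\<lambda>n. \<bar>?Y n\<bar> powr (p - 1) * g x powr p) \<longlonglongrightarrow> 0" by simp
          have "\<bar>f (?Y n) x powr p / ?Y n\<bar> \<le> \<bar>?Y n\<bar> powr (p - 1) * g x powr p" for n
          proof -
            have "f (?Y n) x \<le> \<bar>?Y n\<bar> * g x"
              using spec[OF elim(1), of "?Y n"] True nonneg(1)[of "?Y n" x] by simp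
            then have "f (?Y n) x powr p \<le> (\<bar>?Y n\<bar> * g x) powr p"
              using p nonneg by (intro powr_mono2) auto
            also have "\<dots> = \<bar>?Y n\<bar> * (\<bar>?Y n\<bar> powr (p - 1) * g x powr p)"
              using nonneg(2)[of x] powr_mult_base[of "\<bar>?Y n\<bar>" "p - 1"] by (simp add: powr_mult mult_ac)
            finally show ?thesis using Y(2)[of n] by (simp add: divide_le_eq mult_ac)
          qed
          then have "(\<lambda>n. f (?Y n) x powr p / ?Y n) \<longlonglongrightarrow> 0"
            by (intro Lim_null_comparison[OF _ lim]) auto
          then show ?thesis using True p by simp
        qed
      qed
    qed measurable
    then have "(\<lambda>n. (A (?Y n) - A 0) / ?Y n) \<longlonglongrightarrow> (\<integral>x. p * f 0 x powr (p - 1) * d x \<partial>M)"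
      using int by (simp add: A_def Bochner_Integration.integral_diff)
    then show "((\<lambda>h. (A h - A 0) / h) \<circ> X) \<longlonglongrightarrow> (\<integral>x. p * f 0 x powr (p - 1) * d x \<partial>M)"
      unfolding comp_def by (rule LIMSEQ_offset)
  qed
  then have "(A has_real_derivative (\<integral>x. p * f 0 x powr (p - 1) * d x \<partial>M)) (at 0)"
    by (simp add: has_field_derivative_iff)
  then have "((\<lambda>t. A t powr (1 / p)) has_real_derivative
      (1 / p) * A 0 powr (1 / p - of_nat 1) * (\<integral>x. p * f 0 x powr (p - 1) * d x \<partial>M)) (at 0)"
    by (intro DERIV_fun_powr A0) auto
  also have "(1 / p) * A 0 powr (1 / p - of_nat 1) * (\<integral>x. p * f 0 x powr (p - 1) * d x \<partial>M)
     = (\<integral>x. f 0 x powr (p - 1) * d x \<partial>M) / (A 0 powr (1 / p)) powr (p - 1)"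
  proof -
    have "A 0 powr (1 / p - 1) = inverse ((A 0 powr (1 / p)) powr (p - 1))"
    proof -
      have "1 / p - 1 = - (1 / p * (p - 1))" using p by (simp add: field_simps)
      then show ?thesis by (simp only: powr_powr powr_minus)
    qed
    then show ?thesis using p by (simp add: mult.assoc field_simps)
  qed
  finally show ?thesis by (simp add: N)
qed

section \<open>Integration over one coordinate\<close>

abbreviation coord_upd :: "'n::finite rn \<Rightarrow> 'n \<Rightarrow> real \<Rightarrow> 'n rn" where
  "coord_upd x i t \<equiv> (\<chi> j. if j = i then t else x $ j)"

lemma measurable_vec_lambda [measurable (raw)]:
  fixes f :: "'a \<Rightarrow> 'n::finite \<Rightarrow> real"
  assumes "\<And>i. (\<lambda>x. f x i) \<in> borel_measurable M"
  shows "(\<lambda>x. \<chi> i. f x i) \<in> borel_measurable M"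
proof (subst borel_measurable_euclidean_space, intro ballI)
  fix b :: "'n rn" assume "b \<in> Basis"
  then obtain i where "b = axis i 1" by (auto simp: Basis_vec_def)
  then show "(\<lambda>x. (\<chi> i. f x i) \<bullet> b) \<in> borel_measurable M"
    using assms[of i] by (simp add: inner_axis)
qed

lemma measurable_vec_nth [measurable (raw)]:
  fixes f :: "'a \<Rightarrow> 'n::finite rn"
  shows "f \<in> borel_measurable M \<Longrightarrow> (\<lambda>x. f x $ i) \<in> borel_measurable M"
  by (rule measurable_compose[OF _ borel_measurable_nth])

text \<open>
  The product measure over the index type, for which Fubini is available one coordinate at a time.
\<close>

lemma lborel_vec:
  "(lborel :: ('n::finite rn) measure) = distr (Pi\<^sub>M UNIV (\<lambda>_::'n. lborel)) borel (\<lambda>f. \<chi> i. f i)"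
    (is "_ = distr ?P borel ?V")
proof (rule lborel_eqI)
  interpret product_sigma_finite "\<lambda>_::'n. lborel :: real measure" ..
  have [measurable]: "?V \<in> ?P \<rightarrow>\<^sub>M borel" by measurable
  fix l u :: "'n rn" assume le: "\<And>b. b \<in> Basis \<Longrightarrow> l \<bullet> b \<le> u \<bullet> b"
  have lu: "l $ i \<le> u $ i" for i
    using le[of "axis i 1"] by (auto simp: Basis_vec_def inner_axis)
  have "?V -` box l u \<inter> space ?P = (\<Pi>\<^sub>E i\<in>UNIV. {l $ i <..< u $ i})"
    by (auto simp: mem_box_cart space_PiM PiE_iff)
  then have "emeasure (distr ?P borel ?V) (box l u) = (\<Prod>i\<in>UNIV. emeasure lborel {l $ i <..< u $ i})"
    by (simp add: emeasure_distr emeasure_PiM)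
  also have "\<dots> = (\<Prod>i\<in>UNIV. ennreal (u $ i - l $ i))"
    using lu by simp
  also have "\<dots> = ennreal (\<Prod>i\<in>UNIV. u $ i - l $ i)"
    using lu by (intro prod_ennreal) auto
  also have "(\<Prod>i\<in>UNIV. u $ i - l $ i) = (\<Prod>b\<in>Basis. (u - l) \<bullet> b)"
  proof -
    have "Basis = (\<lambda>i. axis i 1 :: 'n rn) ` UNIV" by (auto simp: Basis_vec_def)
    moreover have "inj (\<lambda>i. axis i 1 :: 'n rn)" by (auto simp: inj_on_def axis_eq_axis)
    ultimately have "(\<Prod>b\<in>Basis. (u - l) \<bullet> b) = (\<Prod>i\<in>UNIV. (u - l) \<bullet> axis i 1)"
      by (metis (no_types, lifting) prod.reindex_cong)
    then show ?thesis by (simp add: inner_axis)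
  qed
  finally show "emeasure (distr ?P borel ?V) (box l u) = (\<Prod>b\<in>Basis. (u - l) \<bullet> b)" .
qed simp

text \<open>
  Tonelli for one coordinate without leaving \<open>\<real>\<^sup>n\<close>.  The inner integral is a function of all of \<open>x\<close>
  that does not see \<open>x\<^sub>i\<close>; the leftover integration over \<open>x\<^sub>i\<close> is absorbed by a weight \<open>w\<close>.  A weight
  of total mass \<open>1\<close> gives integral formulas, and \<open>w = 1\<close> (total mass \<open>\<infinity>\<close>) gives statements on null
  sets.
\<close>

theorem nn_integral_slice:
  fixes f :: "'n::finite rn \<Rightarrow> ennreal" and w :: "real \<Rightarrow> ennreal"
  assumes [measurable]: "f \<in> borel_measurable borel" "w \<in> borel_measurable borel"
  shows "(\<integral>\<^sup>+ x. w (x $ i) * (\<integral>\<^sup>+ t. f (coord_upd x i t) \<partial>lborel) \<partial>lborel)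
       = (\<integral>\<^sup>+ t. w t \<partial>lborel) * (\<integral>\<^sup>+ x. f x \<partial>lborel)"
proof -
  interpret product_sigma_finite "\<lambda>_::'n. lborel :: real measure" ..
  let ?I = "UNIV - {i}" and ?V = "\<lambda>f. (\<chi> i. (f i :: real)) :: 'n rn"
  have nn_insert: "(\<integral>\<^sup>+ x. g x \<partial>lborel) = (\<integral>\<^sup>+ z. \<integral>\<^sup>+ y. g (?V (z(i := y))) \<partial>lborel \<partial>Pi\<^sub>M ?I (\<lambda>_. lborel))"
    if [measurable]: "g \<in> borel_measurable borel" for g :: "'n rn \<Rightarrow> ennreal"
  proof -
    have "(\<integral>\<^sup>+ x. g x \<partial>lborel) = (\<integral>\<^sup>+ z. g (?V z) \<partial>Pi\<^sub>M (insert i ?I) (\<lambda>_. lborel))"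
      by (subst lborel_vec, subst nn_integral_distr) (auto simp: insert_absorb)
    also have "\<dots> = (\<integral>\<^sup>+ z. \<integral>\<^sup>+ y. g (?V (z(i := y))) \<partial>lborel \<partial>Pi\<^sub>M ?I (\<lambda>_. lborel))"
      by (intro product_nn_integral_insert) auto
    finally show ?thesis .
  qed
  have upd: "?V (z(i := t)) = (\<chi> j. if j = i then t else z j)" for z t
    by (simp add: vec_eq_iff)
  have [measurable]: "(\<lambda>z. \<integral>\<^sup>+ y. f (?V (z(i := y))) \<partial>lborel) \<in> borel_measurable (Pi\<^sub>M ?I (\<lambda>_. lborel))"
  proof -
    have [measurable]: "(\<lambda>p. (fst p)(i := snd p)) \<in> Pi\<^sub>M ?I (\<lambda>_. lborel) \<Otimes>\<^sub>M lborel \<rightarrow>\<^sub>M Pi\<^sub>M (insert i ?I) (\<lambda>_. lborel :: real measure)"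
      using measurable_add_dim[of i ?I "\<lambda>_. lborel"] by (simp add: case_prod_beta')
    have "(\<lambda>p. f (?V ((fst p)(i := snd p)))) \<in> borel_measurable (Pi\<^sub>M ?I (\<lambda>_. lborel) \<Otimes>\<^sub>M lborel)"
    proof (rule measurable_compose[of "\<lambda>p. (fst p)(i := snd p)" _ "Pi\<^sub>M (insert i ?I) (\<lambda>_. lborel)" "\<lambda>z. f (?V z)"])
      show "(\<lambda>z. f (?V z)) \<in> borel_measurable (Pi\<^sub>M (insert i ?I) (\<lambda>_. lborel))"
        by (simp add: insert_absorb) measurable
    qed measurable
    then show ?thesis
      using lborel.borel_measurable_nn_integral[of "\<lambda>z y. f (?V (z(i := y)))"] by (simp add: case_prod_beta')
  qed
  have "(\<integral>\<^sup>+ x. w (x $ i) * (\<integral>\<^sup>+ t. f (coord_upd x i t) \<partial>lborel) \<partial>lborel)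
      = (\<integral>\<^sup>+ z. \<integral>\<^sup>+ y. w y * (\<integral>\<^sup>+ t. f (?V (z(i := t))) \<partial>lborel) \<partial>lborel \<partial>Pi\<^sub>M ?I (\<lambda>_. lborel))"
    by (subst nn_insert, measurable) (simp add: upd cong: if_cong)
  also have "\<dots> = (\<integral>\<^sup>+ z. (\<integral>\<^sup>+ y. w y \<partial>lborel) * (\<integral>\<^sup>+ t. f (?V (z(i := t))) \<partial>lborel) \<partial>Pi\<^sub>M ?I (\<lambda>_. lborel))"
    by (simp add: nn_integral_multc)
  also have "\<dots> = (\<integral>\<^sup>+ t. w t \<partial>lborel) * (\<integral>\<^sup>+ x. f x \<partial>lborel)"
    by (subst nn_integral_cmult) (simp_all only: nn_insert assms, measurable)
  finally show ?thesis .
qed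

corollary nn_integral_slice_unit:
  fixes f :: "'n::finite rn \<Rightarrow> ennreal"
  assumes "f \<in> borel_measurable borel"
  shows "(\<integral>\<^sup>+ x. indicator {0..1} (x $ i) * (\<integral>\<^sup>+ t. f (coord_upd x i t) \<partial>lborel) \<partial>lborel) = (\<integral>\<^sup>+ x. f x \<partial>lborel)"
  using nn_integral_slice[OF assms, of "indicator {0..1}" i] by simp

text \<open>
  This makes "almost everywhere on \<open>\<real>\<^sup>n\<close>" sufficient for functions of fewer variables: all exceptional
  sets of the iteration are null sets of \<open>\<real>\<^sup>n\<close>, and no lower dimensional measure is needed.
\<close>

lemma AE_slice_iff:
  fixes P :: "'n::finite rn \<Rightarrow> bool"
  assumes [measurable]: "Measurable.pred borel P"
  shows "(AE x in lborel. AE t in lborel. P (coord_upd x i t)) \<longleftrightarrow> (AE x in lborel. P x)"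
proof -
  define f :: "'n rn \<Rightarrow> ennreal" where "f x = (if P x then 0 else 1)" for x
  have [measurable]: "f \<in> borel_measurable borel" unfolding f_def by measurable
  have "(AE x in lborel. AE t in lborel. P (coord_upd x i t))
      \<longleftrightarrow> (AE x in lborel. (\<integral>\<^sup>+ t. f (coord_upd x i t) \<partial>lborel) = 0)"
    by (subst nn_integral_0_iff_AE) (auto simp: f_def)
  also have "\<dots> \<longleftrightarrow> (\<integral>\<^sup>+ x. 1 * (\<integral>\<^sup>+ t. f (coord_upd x i t) \<partial>lborel) \<partial>lborel) = 0"
    by (subst nn_integral_0_iff_AE) auto
  also have "\<dots> \<longleftrightarrow> (\<integral>\<^sup>+ x. f x \<partial>lborel) = 0"
    by (subst nn_integral_slice[where w = "\<lambda>_. 1"]) auto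
  also have "\<dots> \<longleftrightarrow> (AE x in lborel. P x)"
    by (subst nn_integral_0_iff_AE) (auto simp: f_def)
  finally show ?thesis .
qed

lemma AE_slice:
  fixes P :: "'n::finite rn \<Rightarrow> bool"
  assumes "AE x in lborel. P x"
  shows "AE x in lborel. AE t in lborel. P (coord_upd x i t)"
proof -
  obtain N where N: "{x \<in> space lborel. \<not> P x} \<subseteq> N" "emeasure lborel N = 0" "N \<in> sets lborel"
    using AE_E[OF assms] by blast
  then have [measurable]: "N \<in> sets borel" by simp
  have "AE x in lborel. x \<notin> N" using N by (intro AE_not_in null_setsI)
  then have "AE x in lborel. AE t in lborel. coord_upd x i t \<notin> N"
    by (subst AE_slice_iff) auto
  then show ?thesis
  proof eventually_elim
    case (elim x)
    then show ?case by eventually_elim (use N in auto)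
  qed
qed

text \<open>
  The signed version: replacing the coordinate \<open>x\<^sub>i\<close> by a new variable \<open>t\<close> maps the measure
  \<open>1\<^bsub>[0,1]\<^esub>(x\<^sub>i) dx dt\<close> to Lebesgue measure on \<open>\<real>\<^sup>n\<close>, so Fubini on \<open>\<real>\<^sup>n \<times> \<real>\<close> applies.
\<close>

theorem integral_slice_unit:
  fixes f :: "'n::finite rn \<Rightarrow> real"
  assumes int: "integrable lborel f"
  shows "integrable lborel (\<lambda>x. indicator {0..1} (x $ i) * (LINT t|lborel. f (coord_upd x i t)))" (is ?A)
    and "(LINT x|lborel. indicator {0..1} (x $ i) * (LINT t|lborel. f (coord_upd x i t))) = (LINT x|lborel. f x)" (is ?B)
proof -
  have [measurable]: "f \<in> borel_measurable borel" using int by auto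
  let ?w = "\<lambda>z::'n rn \<times> real. indicator {0..1} (fst z $ i) :: real"
  let ?T = "\<lambda>z::'n rn \<times> real. coord_upd (fst z) i (snd z)"
  have [measurable]: "?w \<in> borel_measurable (lborel \<Otimes>\<^sub>M lborel)" "?T \<in> lborel \<Otimes>\<^sub>M lborel \<rightarrow>\<^sub>M borel"
    by measurable
  have eq: "distr (density (lborel \<Otimes>\<^sub>M lborel) ?w) borel ?T = lborel"
  proof (rule measure_eqI)
    fix A assume "A \<in> sets (distr (density (lborel \<Otimes>\<^sub>M lborel) ?w) borel ?T)"
    then have [measurable]: "A \<in> sets borel" by simp
    have "emeasure (distr (density (lborel \<Otimes>\<^sub>M lborel) ?w) borel ?T) A
        = (\<integral>\<^sup>+ z. indicator A (?T z) \<partial>density (lborel \<Otimes>\<^sub>M lborel) ?w)"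
      by (subst nn_integral_indicator[symmetric], simp, subst nn_integral_distr) auto
    also have "\<dots> = (\<integral>\<^sup>+ z. ennreal (?w z) * indicator A (?T z) \<partial>(lborel \<Otimes>\<^sub>M lborel))"
      by (subst nn_integral_density) auto
    also have "\<dots> = (\<integral>\<^sup>+ x. \<integral>\<^sup>+ t. ennreal (?w (x, t)) * indicator A (?T (x, t)) \<partial>lborel \<partial>lborel)"
      by (subst lborel.nn_integral_fst[symmetric]) auto
    also have "\<dots> = (\<integral>\<^sup>+ x. indicator {0..1} (x $ i) * (\<integral>\<^sup>+ t. indicator A (coord_upd x i t) \<partial>lborel) \<partial>lborel)"
      by (simp add: nn_integral_cmult ennreal_indicator cong: if_cong)
    also have "\<dots> = (\<integral>\<^sup>+ x. indicator A x \<partial>lborel)"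
      by (rule nn_integral_slice_unit) auto
    finally show "emeasure (distr (density (lborel \<Otimes>\<^sub>M lborel) ?w) borel ?T) A = emeasure lborel A"
      by simp
  qed simp
  have int': "integrable (lborel \<Otimes>\<^sub>M lborel) (\<lambda>z. ?w z *\<^sub>R f (?T z))"
    using int by (subst (asm) eq[symmetric], subst (asm) integrable_distr_eq, simp, simp,
        subst (asm) integrable_density) auto
  have slice: "(LINT t|lborel. ?w (x, t) *\<^sub>R f (?T (x, t)))
      = indicator {0..1} (x $ i) * (LINT t|lborel. f (coord_upd x i t))" for x
    by (simp cong: if_cong)
  show ?A
    using lborel_pair.integrable_fst'[OF int'] by (simp only: slice)
  have "(LINT x|lborel. f x) = (LINT z|(lborel \<Otimes>\<^sub>M lborel). ?w z *\<^sub>R f (?T z))"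
    by (subst eq[symmetric], subst integral_distr, simp, simp, subst integral_density) auto
  then show ?B
    using lborel_pair.integral_fst'[OF int'] by (simp only: slice)
qed

section \<open>The iterated norms\<close>

lemma coord_bij: "bij_betw (coord :: nat \<Rightarrow> 'n::{finite,linorder}) {1..CARD('n)} UNIV"
proof -
  let ?L = "sorted_list_of_set (UNIV :: 'n set)"
  have "bij_betw ((!) ?L) {..<length ?L} (set ?L)"
    by (intro bij_betw_nth) auto
  then have "bij_betw ((!) ?L) {..<CARD('n)} UNIV" by simp
  moreover have "bij_betw (\<lambda>k. k - 1) {1..CARD('n)} {..<CARD('n)}"
    by (rule bij_betw_byWitness[where f' = Suc]) auto
  ultimately have "bij_betw ((!) ?L \<circ> (\<lambda>k. k - 1)) {1..CARD('n)} UNIV"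
    by (rule bij_betw_trans[rotated])
  then show ?thesis by (simp add: comp_def coord_def[abs_def])
qed

lemma coord_eq_iff:
  assumes "1 \<le> i" "i \<le> CARD('n)" "1 \<le> j" "j \<le> CARD('n)"
  shows "(coord i :: 'n::{finite,linorder}) = coord j \<longleftrightarrow> i = j"
  using bij_betw_imp_inj_on[OF coord_bij[where 'n = 'n]] assms by (auto dest: inj_onD)

lemma coord_first_le: "coord 1 \<le> (i :: 'n::{finite,linorder})"
proof -
  let ?L = "sorted_list_of_set (UNIV :: 'n set)"
  have "i \<in> set ?L" by simp
  then obtain m where m: "m < length ?L" "?L ! m = i" by (auto simp: in_set_conv_nth simp del: set_sorted_list_of_set)
  then have "?L ! 0 \<le> ?L ! m" by (intro sorted_nth_mono) auto
  with m show ?thesis by (simp add: coord_def)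
qed

declare mixed_I.simps(2) [simp del]

lemma mixed_I_Suc:
  "mixed_I p u (Suc k) x = Lp_norm lborel (p $ coord (Suc k)) (\<lambda>t. mixed_I p u k (coord_upd x (coord (Suc k)) t))"
  by (simp add: mixed_I.simps(2) Lp_norm_def)

lemma measurable_mixed_I [measurable]:
  assumes [measurable]: "u \<in> borel_measurable borel"
  shows "mixed_I p u k \<in> borel_measurable borel"
proof (induction k)
  case (Suc k)
  note [measurable] = Suc
  show ?case unfolding mixed_I.simps(2) by measurable
qed simp

lemma coord_upd_cong:
  assumes "\<And>j. j \<notin> coord ` {1..Suc k} \<Longrightarrow> x $ j = y $ j"
    and "j \<notin> coord ` {1..k}"
  shows "coord_upd x (coord (Suc k)) t $ j = coord_upd y (coord (Suc k)) t $ j"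
  using assms by (auto simp: atLeastAtMostSuc_conv)

lemma mixed_I_cong:
  assumes "\<And>j. j \<notin> coord ` {1..k} \<Longrightarrow> x $ j = y $ j"
  shows "mixed_I p u k x = mixed_I p u k y"
  using assms
proof (induction k arbitrary: x y)
  case 0
  then have "x = y" by (simp add: vec_eq_iff)
  then show ?case by simp
next
  case (Suc k)
  have "mixed_I p u k (coord_upd x (coord (Suc k)) t) = mixed_I p u k (coord_upd y (coord (Suc k)) t)" for t
    by (rule Suc.IH) (rule coord_upd_cong[OF Suc.prems])
  then show ?case by (simp add: mixed_I_Suc)
qed

lemma mixed_I_coord_upd:
  assumes "1 \<le> k" "k \<le> m"
  shows "mixed_I p u m (coord_upd x (coord k) t) = mixed_I p u m x"
  using assms by (intro mixed_I_cong) auto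

lemma mixed_I_CARD:
  "mixed_I p u CARD('n) x = mixed_norm p (u :: 'n::{finite,linorder} rn \<Rightarrow> real)"
  unfolding mixed_norm_def
  by (rule mixed_I_cong) (use bij_betw_imp_surj_on[OF coord_bij[where 'n = 'n]] in simp)

locale mixed_exponents =
  fixes p :: "'n::{finite,linorder} rn"
  assumes p_gt_1: "1 < p $ i"
begin

lemma p_pos: "0 < p $ i" and p_nz: "p $ i \<noteq> 0"
  using p_gt_1[of i] by simp_all

lemma mixed_I_mono:
  assumes "\<And>x. \<bar>u x\<bar> \<le> \<bar>v x\<bar>"
  shows "mixed_I p u k x \<le> mixed_I p v k x"
proof (induction k arbitrary: x)
  case (Suc k)
  then show ?case unfolding mixed_I_Suc by (intro Lp_norm_mono p_pos)
qed (simp add: assms ennreal_leI)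

lemma mixed_I_add:
  assumes [measurable]: "u \<in> borel_measurable borel" "v \<in> borel_measurable borel"
  shows "mixed_I p (\<lambda>x. u x + v x) k x \<le> mixed_I p u k x + mixed_I p v k x"
proof (induction k arbitrary: x)
  case 0
  show ?case by (simp add: ennreal_plus[symmetric] ennreal_leI del: ennreal_plus)
next
  case (Suc k)
  have "mixed_I p (\<lambda>x. u x + v x) (Suc k) x \<le>
     Lp_norm lborel (p $ coord (Suc k)) (\<lambda>t. mixed_I p u k (coord_upd x (coord (Suc k)) t)
       + mixed_I p v k (coord_upd x (coord (Suc k)) t))"
    unfolding mixed_I_Suc by (intro Lp_norm_mono p_pos Suc)
  also have "\<dots> \<le> mixed_I p u (Suc k) x + mixed_I p v (Suc k) x"
    unfolding mixed_I_Suc by (intro Minkowski_Lp_norm p_gt_1) measurable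
  finally show ?case .
qed

lemma mixed_I_cmult:
  assumes [measurable]: "u \<in> borel_measurable borel"
  shows "mixed_I p (\<lambda>x. c * u x) k x = ennreal \<bar>c\<bar> * mixed_I p u k x"
proof (induction k arbitrary: x)
  case 0
  show ?case by (simp add: abs_mult ennreal_mult)
next
  case (Suc k)
  show ?case unfolding mixed_I_Suc Suc by (intro Lp_norm_cmult p_nz) measurable
qed

lemma mixed_I_finite_AE:
  assumes [measurable]: "u \<in> borel_measurable borel" and fin: "mixed_norm p u < top"
    and "k \<le> CARD('n)"
  shows "AE x in lborel. mixed_I p u k x < top"
  using \<open>k \<le> CARD('n)\<close>
proof (induction rule: inc_induct)
  case base
  then show ?case using fin by (simp add: mixed_I_CARD)
next
  case (step k)
  from step(3) have "AE x in lborel. AE t in lborel. mixed_I p u k (coord_upd x (coord (Suc k)) t) < top"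
    by eventually_elim (auto simp: mixed_I_Suc intro!: Lp_norm_finite_AE)
  then show ?case by (subst (asm) AE_slice_iff) auto
qed

lemma mixed_norm_eq_0_AE:
  assumes [measurable]: "u \<in> borel_measurable borel" and zero: "mixed_norm p u = 0"
  shows "AE x in lborel. u x = 0"
proof -
  have "AE x in lborel. mixed_I p u k x = 0" if "k \<le> CARD('n)" for k
    using that
  proof (induction rule: inc_induct)
    case base
    then show ?case using zero by (simp add: mixed_I_CARD)
  next
    case (step k)
    from step(3) have "AE x in lborel. AE t in lborel. mixed_I p u k (coord_upd x (coord (Suc k)) t) = 0"
      by eventually_elim (auto simp: mixed_I_Suc intro!: Lp_norm_eq_0_AE)
    then show ?case by (subst (asm) AE_slice_iff) auto
  qed
  from this[of 0] show ?thesis by simp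
qed

text \<open>
  Minkowski for \<open>u + t v\<close> and for \<open>u = (u + t v) - t v\<close>: this is the Lipschitz hypothesis of
  \<open>Lp_norm_has_derivative\<close> for the next integration.
\<close>

lemma mixed_I_perturb:
  assumes [measurable]: "u \<in> borel_measurable borel" "v \<in> borel_measurable borel"
    and fin: "mixed_I p u k x < top" "mixed_I p v k x < top"
  shows "mixed_I p (\<lambda>x. u x + t * v x) k x < top"
    and "\<bar>enn2real (mixed_I p (\<lambda>x. u x + t * v x) k x) - enn2real (mixed_I p u k x)\<bar>
         \<le> \<bar>t\<bar> * enn2real (mixed_I p v k x)"
proof -
  let ?U = "\<lambda>t. mixed_I p (\<lambda>x. u x + t * v x) k x"
  have 1: "?U t \<le> mixed_I p u k x + ennreal \<bar>t\<bar> * mixed_I p v k x"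
    using mixed_I_add[of u "\<lambda>x. t * v x" k x] by (simp add: mixed_I_cmult)
  also have "\<dots> < top" using fin by (simp add: ennreal_mult_less_top)
  finally show fint: "?U t < top" .
  have 2: "mixed_I p u k x \<le> ?U t + ennreal \<bar>t\<bar> * mixed_I p v k x"
    using mixed_I_add[of "\<lambda>x. u x + t * v x" "\<lambda>x. - t * v x" k x] mixed_I_cmult[of v "- t" k x] by simp
  obtain a where a: "?U t = ennreal a" "0 \<le> a" using fint by (cases "?U t") auto
  obtain b where b: "mixed_I p u k x = ennreal b" "0 \<le> b" using fin(1) by (cases "mixed_I p u k x") auto
  obtain c where c: "mixed_I p v k x = ennreal c" "0 \<le> c" using fin(2) by (cases "mixed_I p v k x") auto
  note abc = a b c
  from 1 have "a \<le> b + \<bar>t\<bar> * c"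
    using abc by (simp add: ennreal_mult[symmetric] ennreal_plus[symmetric] del: ennreal_plus)
  moreover from 2 have "b \<le> a + \<bar>t\<bar> * c"
    using abc by (simp add: ennreal_mult[symmetric] ennreal_plus[symmetric] del: ennreal_plus)
  ultimately show "\<bar>enn2real (?U t) - enn2real (mixed_I p u k x)\<bar> \<le> \<bar>t\<bar> * enn2real (mixed_I p v k x)"
    using abc by simp
qed

end

section \<open>The derivative of the mixed norm\<close>

text \<open>
  The candidate for the derivative of \<open>t \<mapsto> I\<^sub>k(u + t v)\<close> at \<open>0\<close>, obtained by applying the formula for the
  derivative of an \<open>L\<^sup>p\<close> norm once for each variable.
\<close>

primrec mixed_dI ::
  "'n::{finite,linorder} rn \<Rightarrow> ('n rn \<Rightarrow> real) \<Rightarrow> ('n rn \<Rightarrow> real) \<Rightarrow> nat \<Rightarrow> 'n rn \<Rightarrow> real" where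
  "mixed_dI p u v 0 = (\<lambda>x. sgn (u x) * v x)"
| "mixed_dI p u v (Suc k) = (\<lambda>x.
     (LINT t|lborel. enn2real (mixed_I p u k (coord_upd x (coord (Suc k)) t)) powr (p $ coord (Suc k) - 1)
        * mixed_dI p u v k (coord_upd x (coord (Suc k)) t))
     / enn2real (mixed_I p u (Suc k) x) powr (p $ coord (Suc k) - 1))"

lemma measurable_mixed_dI [measurable]:
  assumes [measurable]: "u \<in> borel_measurable borel" "v \<in> borel_measurable borel"
  shows "mixed_dI p u v k \<in> borel_measurable borel"
proof (induction k)
  case (Suc k)
  note [measurable] = Suc
  show ?case unfolding mixed_dI.simps by measurable
next
  case 0
  show ?case unfolding mixed_dI.simps by measurable
qed

lemma mixed_dI_cong:
  assumes "\<And>j. j \<notin> coord ` {1..k} \<Longrightarrow> x $ j = y $ j"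
  shows "mixed_dI p u v k x = mixed_dI p u v k y"
  using assms
proof (induction k arbitrary: x y)
  case 0
  then have "x = y" by (simp add: vec_eq_iff)
  then show ?case by simp
next
  case (Suc k)
  have "mixed_dI p u v k (coord_upd x (coord (Suc k)) t) = mixed_dI p u v k (coord_upd y (coord (Suc k)) t)" for t
    by (rule Suc.IH) (rule coord_upd_cong[OF Suc.prems])
  moreover have "mixed_I p u k (coord_upd x (coord (Suc k)) t) = mixed_I p u k (coord_upd y (coord (Suc k)) t)" for t
    by (rule mixed_I_cong) (rule coord_upd_cong[OF Suc.prems])
  moreover have "mixed_I p u (Suc k) x = mixed_I p u (Suc k) y"
    by (rule mixed_I_cong) (rule Suc.prems)
  ultimately show ?case by simp
qed

lemma mixed_dI_CARD:
  "mixed_dI p u v CARD('n) x = mixed_dI p (u :: 'n::{finite,linorder} rn \<Rightarrow> real) v CARD('n) y"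
  by (rule mixed_dI_cong) (use bij_betw_imp_surj_on[OF coord_bij[where 'n = 'n]] in simp)

lemma abs_has_derivative:
  assumes "(a::real) \<noteq> 0"
  shows "((\<lambda>t. \<bar>a + t * b\<bar>) has_real_derivative sgn a * b) (at 0)"
proof -
  have "((\<lambda>t. a + t * b) has_real_derivative b) (at 0)"
    by (auto intro!: derivative_eq_intros)
  then have "((\<lambda>t. sgn a * (a + t * b)) has_real_derivative sgn a * b) (at 0)"
    by (rule DERIV_cmult)
  moreover have "\<forall>\<^sub>F t in nhds 0. sgn a * (a + t * b) = \<bar>a + t * b\<bar>"
  proof -
    have pos: "sgn a * (a + 0 * b) > 0" using assms by (simp add: sgn_if)
    have lim: "((\<lambda>t. sgn a * (a + t * b)) \<longlongrightarrow> sgn a * (a + 0 * b)) (nhds 0)"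
      by (intro tendsto_intros) (auto simp: filterlim_ident)
    have "\<forall>\<^sub>F t in nhds 0. sgn a * (a + t * b) > 0"
      by (rule order_tendstoD(1)[OF lim pos])
    then show ?thesis by eventually_elim (use assms in \<open>auto simp: sgn_if abs_if split: if_splits\<close>)
  qed
  ultimately show ?thesis by (subst (asm) DERIV_cong_ev[OF refl _ refl]) auto
qed

context mixed_exponents
begin

text \<open>
  Induction on the number of integrated variables.  For almost every \<open>x\<close>, the values at level \<open>k\<close> are
  finite almost everywhere on the line through \<open>x\<close> in the next direction, and the induction hypothesis
  holds almost everywhere on it; \<open>Lp_norm_has_derivative\<close> on that line gives level \<open>k + 1\<close>.
\<close>

lemma mixed_I_has_derivative:
  assumes [measurable]: "u \<in> borel_measurable borel" "v \<in> borel_measurable borel"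
    and fin: "mixed_norm p u < top" "mixed_norm p v < top" and "k \<le> CARD('n)"
  shows "AE x in lborel. mixed_I p u k x \<noteq> 0 \<longrightarrow>
    ((\<lambda>t. enn2real (mixed_I p (\<lambda>x. u x + t * v x) k x)) has_real_derivative mixed_dI p u v k x) (at 0)"
  using \<open>k \<le> CARD('n)\<close>
proof (induction k)
  case 0
  show ?case by (auto simp: enn2real_ennreal[OF abs_ge_zero] intro!: abs_has_derivative)
next
  case (Suc k)
  let ?c = "coord (Suc k)"
  let ?U = "\<lambda>t k x. mixed_I p (\<lambda>x. u x + t * v x) k x"
  have good: "AE x in lborel. mixed_I p u k x < top \<and> mixed_I p v k x < top" if "k \<le> CARD('n)" for k
    using mixed_I_finite_AE[of u k] mixed_I_finite_AE[of v k] fin that by (auto intro: AE_conjI)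
  have "AE x in lborel. AE t in lborel. mixed_I p u k (coord_upd x ?c t) < top \<and> mixed_I p v k (coord_upd x ?c t) < top
     \<and> (mixed_I p u k (coord_upd x ?c t) \<noteq> 0 \<longrightarrow>
    ((\<lambda>\<tau>. enn2real (?U \<tau> k (coord_upd x ?c t))) has_real_derivative mixed_dI p u v k (coord_upd x ?c t)) (at 0))"
    using AE_conjI[OF good[of k] Suc.IH] Suc.prems by (intro AE_slice) (simp add: conj_assoc)
  with good[OF Suc.prems] show ?case
  proof eventually_elim
    case (elim x)
    show ?case
    proof
      assume nz: "mixed_I p u (Suc k) x \<noteq> 0"
      let ?f = "\<lambda>\<tau> t. enn2real (?U \<tau> k (coord_upd x ?c t))"
      let ?g = "\<lambda>t. enn2real (mixed_I p v k (coord_upd x ?c t))"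
      let ?d = "\<lambda>t. mixed_dI p u v k (coord_upd x ?c t)"
      have slice: "AE t in lborel. ?U \<tau> k (coord_upd x ?c t) < top" for \<tau>
        using elim(2) by eventually_elim (auto intro: mixed_I_perturb)
      have slice_v: "AE t in lborel. mixed_I p v k (coord_upd x ?c t) < top"
        using elim(2) by eventually_elim auto
      have f: "Lp_norm lborel (p $ ?c) (\<lambda>t. ennreal (?f \<tau> t)) = ?U \<tau> (Suc k) x" for \<tau>
        unfolding mixed_I_Suc by (intro Lp_norm_cong_AE eventually_mono[OF slice[of \<tau>]]) (auto simp: ennreal_enn2real_if)
      have g: "Lp_norm lborel (p $ ?c) (\<lambda>t. ennreal (?g t)) = mixed_I p v (Suc k) x"
        unfolding mixed_I_Suc by (intro Lp_norm_cong_AE eventually_mono[OF slice_v]) (auto simp: ennreal_enn2real_if)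
      have "((\<lambda>\<tau>. enn2real (Lp_norm lborel (p $ ?c) (\<lambda>t. ennreal (?f \<tau> t)))) has_real_derivative
        (LINT t|lborel. ?f 0 t powr (p $ ?c - 1) * ?d t)
         / enn2real (Lp_norm lborel (p $ ?c) (\<lambda>t. ennreal (?f 0 t))) powr (p $ ?c - 1)) (at 0)"
      proof (rule Lp_norm_has_derivative[where g = ?g])
        show "AE t in lborel. \<forall>\<tau>. \<bar>?f \<tau> t - ?f 0 t\<bar> \<le> \<bar>\<tau>\<bar> * ?g t"
          using elim(2) by eventually_elim (auto intro: mixed_I_perturb)
        show "AE t in lborel. ?f 0 t \<noteq> 0 \<longrightarrow> ((\<lambda>\<tau>. ?f \<tau> t) has_real_derivative ?d t) (at 0)"
          using elim(2) by eventually_elim auto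
        show "Lp_norm lborel (p $ ?c) (\<lambda>t. ennreal (?f 0 t)) < top"
          using elim(1) by (subst f) simp
        show "Lp_norm lborel (p $ ?c) (\<lambda>t. ennreal (?g t)) < top"
          using elim(1) by (subst g) simp
        show "Lp_norm lborel (p $ ?c) (\<lambda>t. ennreal (?f 0 t)) \<noteq> 0"
          using nz by (subst f) simp
      qed (auto intro!: p_gt_1)
      then show "((\<lambda>t. enn2real (?U t (Suc k) x)) has_real_derivative mixed_dI p u v (Suc k) x) (at 0)"
        unfolding f by simp
    qed
  qed
qed

corollary mixed_norm_has_derivative:
  assumes "u \<in> borel_measurable borel" "v \<in> borel_measurable borel"
    and "mixed_norm p u < top" "mixed_norm p v < top" and nz: "mixed_norm p u \<noteq> 0"
  shows "((\<lambda>t. enn2real (mixed_norm p (\<lambda>x. u x + t * v x))) has_real_derivative mixed_dI p u v CARD('n) 0) (at 0)"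
proof -
  have "AE x in lborel. ((\<lambda>t. enn2real (mixed_norm p (\<lambda>x. u x + t * v x))) has_real_derivative
      mixed_dI p u v CARD('n) (x :: 'n rn)) (at 0)"
    using mixed_I_has_derivative[OF assms(1-4) order_refl] nz by (simp add: mixed_I_CARD)
  then have "AE x :: 'n rn in lborel. ((\<lambda>t. enn2real (mixed_norm p (\<lambda>x. u x + t * v x))) has_real_derivative
      mixed_dI p u v CARD('n) 0) (at 0)"
    by (subst (asm) mixed_dI_CARD[of p u v _ 0])
  \<comment> \<open>a statement that does not involve \<open>x\<close> and holds for almost every \<open>x\<close> is true, as \<open>\<real>\<^sup>n\<close> is not a null set\<close>
  moreover have "ae_filter (lborel :: 'n rn measure) \<noteq> bot"
    by (simp add: ae_filter_eq_bot_iff)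
  ultimately show ?thesis by (simp add: eventually_const)
qed

end

section \<open>The derivative as an integral over \<open>\<real>\<^sup>n\<close>\<close>

text \<open>
  The indicator of the unit cube in the first \<open>k\<close> coordinates: the accumulated weights
  \<open>1\<^bsub>[0,1]\<^esub>(x\<^sub>i)\<close> of \<open>integral_slice_unit\<close> after \<open>k\<close> integrations.
\<close>

definition unit_cube :: "nat \<Rightarrow> 'n::{finite,linorder} rn \<Rightarrow> real" where
  "unit_cube k x = (\<Prod>i\<in>{1..k}. indicator {0..1} (x $ coord i))"

lemma unit_cube_nonneg: "0 \<le> unit_cube k x"
  unfolding unit_cube_def by (intro prod_nonneg) auto

lemma measurable_unit_cube [measurable]: "unit_cube k \<in> borel_measurable borel"
  unfolding unit_cube_def by measurable

lemma unit_cube_Suc: "unit_cube (Suc k) x = indicator {0..1} (x $ coord (Suc k)) * unit_cube k x"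
  by (simp add: unit_cube_def mult.commute)

lemma unit_cube_coord_upd:
  fixes x :: "'n::{finite,linorder} rn"
  assumes "k < CARD('n)"
  shows "unit_cube k (coord_upd x (coord (Suc k)) t) = unit_cube k x"
  unfolding unit_cube_def using assms
  by (intro prod.cong) (auto simp: coord_eq_iff)

lemma unit_cube_CARD:
  shows "(LINT x|lborel. unit_cube CARD('n) (x :: 'n::{finite,linorder} rn)) = 1" (is ?A)
    and "(\<integral>\<^sup>+ x. ennreal (unit_cube CARD('n) (x :: 'n rn)) \<partial>lborel) = 1" (is ?B)
proof -
  have cube: "unit_cube CARD('n) x = indicator (cbox 0 ((\<chi> _. 1) :: 'n rn)) x" for x :: "'n rn"
  proof -
    have "unit_cube CARD('n) x = (\<Prod>j\<in>UNIV. indicator {0..1} (x $ j))"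
      unfolding unit_cube_def by (rule prod.reindex_bij_betw[OF coord_bij])
    also have "\<dots> = indicator {x. \<forall>j. x $ j \<in> {0..1}} x"
      by (auto simp: indicator_def prod_eq_1_iff)
    also have "{x. \<forall>j. x $ j \<in> {0..1}} = cbox 0 ((\<chi> _. 1) :: 'n rn)"
      by (auto simp: mem_box_cart)
    finally show ?thesis .
  qed
  have "(0 :: 'n rn) \<in> cbox 0 ((\<chi> _. 1) :: 'n rn)" by (simp add: mem_box_cart)
  then have content: "measure lborel (cbox 0 ((\<chi> _. 1) :: 'n rn)) = 1"
    by (subst content_cbox_cart) auto
  then have emeasure: "emeasure lborel (cbox 0 ((\<chi> _. 1) :: 'n rn)) = 1"
    using emeasure_eq_ennreal_measure[of lborel "cbox 0 ((\<chi> _. 1) :: 'n rn)"]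
      emeasure_lborel_cbox_finite[of "0 :: 'n rn" "(\<chi> _. 1) :: 'n rn"] by simp
  show ?A unfolding cube using content by simp
  show ?B unfolding cube by (simp add: ennreal_indicator emeasure)
qed

text \<open>
  The factors of \<open>\<F>\<^sub>p(u)\<close> that are still constant in the integration over the \<open>(k+1)\<close>-st variable.
\<close>

definition F_weight :: "'n::{finite,linorder} rn \<Rightarrow> ('n rn \<Rightarrow> real) \<Rightarrow> nat \<Rightarrow> 'n rn \<Rightarrow> real" where
  "F_weight p u k x =
     (\<Prod>i\<in>{Suc k..CARD('n)}. enn2real (mixed_I p u i x) powr (ext_exp p (i + 1) - ext_exp p i))"

lemma F_weight_nonneg: "0 \<le> F_weight p u k x"
  unfolding F_weight_def by (intro prod_nonneg) auto

lemma measurable_F_weight [measurable]: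
  "u \<in> borel_measurable borel \<Longrightarrow> F_weight p u k \<in> borel_measurable borel"
  unfolding F_weight_def by measurable

lemma F_weight_Suc:
  fixes x :: "'n::{finite,linorder} rn"
  assumes "k < CARD('n)"
  shows "F_weight p u k x =
    enn2real (mixed_I p u (Suc k) x) powr (ext_exp p (Suc (Suc k)) - ext_exp p (Suc k)) * F_weight p u (Suc k) x"
  unfolding F_weight_def using assms by (subst prod.atLeast_Suc_atMost) auto

lemma F_weight_coord_upd: "F_weight p u k (coord_upd x (coord (Suc k)) t) = F_weight p u k x"
  unfolding F_weight_def by (intro prod.cong) (auto simp: mixed_I_coord_upd)

lemma F_weight_CARD: "F_weight p u CARD('n) (x :: 'n::{finite,linorder} rn) = 1"
  by (simp add: F_weight_def)

lemma ext_exp_Suc: "k < CARD('n) \<Longrightarrow> ext_exp (p :: 'n::{finite,linorder} rn) (Suc k) = p $ coord (Suc k)"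
  by (simp add: ext_exp_def)

lemma F_op_eq:
  "F_op p u x * v x = F_weight p u 0 x * enn2real (mixed_I p u 0 x) powr (ext_exp p 1 - 1) * mixed_dI p u v 0 x"
proof (cases "u x = 0")
  case False
  have "\<bar>u x\<bar> powr (ext_exp p 1 - 1) = \<bar>u x\<bar> powr (ext_exp p 1 - 2) * \<bar>u x\<bar>"
    using powr_mult_base[of "\<bar>u x\<bar>" "ext_exp p 1 - 2"] by (simp add: mult.commute)
  then have "\<bar>u x\<bar> powr (ext_exp p 1 - 2) * u x = \<bar>u x\<bar> powr (ext_exp p 1 - 1) * sgn (u x)"
    by (simp add: abs_mult_sgn mult.assoc)
  with False show ?thesis
    by (simp add: F_op_def F_weight_def)
qed (simp add: F_op_def)

lemma measurable_F_op_mult: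
  assumes [measurable]: "u \<in> borel_measurable borel" "v \<in> borel_measurable borel"
  shows "(\<lambda>x. F_op p u x * v x) \<in> borel_measurable borel"
proof -
  have "(\<lambda>x. F_weight p u k x * enn2real (mixed_I p u k x) powr (ext_exp p 1 - 1) * mixed_dI p u v k x)
      \<in> borel_measurable borel" for k
    by measurable
  moreover have "(\<lambda>x. F_op p u x * v x) = (\<lambda>x. F_weight p u 0 x
      * enn2real (mixed_I p u 0 x) powr (ext_exp p 1 - 1) * mixed_dI p u v 0 x)"
    by (intro ext F_op_eq)
  ultimately show ?thesis by simp
qed

context mixed_exponents
begin

text \<open>
  Hoelder in the \<open>(k+1)\<close>-st variable produces \<open>I\<^sub>k\<^sub>+\<^sub>1(u)\<close> to the power \<open>p\<^sub>k\<^sub>+\<^sub>1 - 1\<close>, and the factor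
  \<open>I\<^sub>k\<^sub>+\<^sub>1(u)\<close> of the weight, of power \<open>p\<^sub>k\<^sub>+\<^sub>2 - p\<^sub>k\<^sub>+\<^sub>1\<close>, raises it to \<open>p\<^sub>k\<^sub>+\<^sub>2 - 1\<close>.  Where \<open>I\<^sub>k\<^sub>+\<^sub>1(u)\<close> is
  \<open>0\<close> or \<open>\<infinity>\<close> the weight vanishes by convention, so the inequality holds there too.
\<close>

lemma nn_integral_F_step:
  fixes k :: nat
  assumes [measurable]: "u \<in> borel_measurable borel" "v \<in> borel_measurable borel" and k: "k < CARD('n)"
  shows "(\<integral>\<^sup>+ x. ennreal (unit_cube k x * F_weight p u k x)
        * (epowr (mixed_I p u k x) (ext_exp p (Suc k) - 1) * mixed_I p v k x) \<partial>lborel)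
    \<le> (\<integral>\<^sup>+ x. ennreal (unit_cube (Suc k) x * F_weight p u (Suc k) x)
        * (epowr (mixed_I p u (Suc k) x) (ext_exp p (Suc (Suc k)) - 1) * mixed_I p v (Suc k) x) \<partial>lborel)"
    (is "(\<integral>\<^sup>+ x. ?\<Psi> k x \<partial>lborel) \<le> (\<integral>\<^sup>+ x. ?\<Psi> (Suc k) x \<partial>lborel)")
proof -
  let ?c = "coord (Suc k)"
  have "(\<integral>\<^sup>+ x. ?\<Psi> k x \<partial>lborel) = (\<integral>\<^sup>+ x. indicator {0..1} (x $ ?c) * (\<integral>\<^sup>+ t. ?\<Psi> k (coord_upd x ?c t) \<partial>lborel) \<partial>lborel)"
    by (rule nn_integral_slice_unit[symmetric]) measurable
  also have "\<dots> \<le> (\<integral>\<^sup>+ x. ?\<Psi> (Suc k) x \<partial>lborel)"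
  proof (intro nn_integral_mono)
    fix x :: "'n rn"
    let ?w = "unit_cube k x * F_weight p u k x" and ?I = "mixed_I p u (Suc k) x"
    have "(\<integral>\<^sup>+ t. ?\<Psi> k (coord_upd x ?c t) \<partial>lborel)
       = ennreal ?w * (\<integral>\<^sup>+ t. epowr (mixed_I p u k (coord_upd x ?c t)) (p $ ?c - 1) * mixed_I p v k (coord_upd x ?c t) \<partial>lborel)"
      unfolding unit_cube_coord_upd[OF k] F_weight_coord_upd ext_exp_Suc[OF k]
      by (rule nn_integral_cmult) measurable
    also have "\<dots> \<le> ennreal ?w * (epowr ?I (p $ ?c - 1) * mixed_I p v (Suc k) x)"
      unfolding mixed_I_Suc by (intro mult_left_mono Holder_Lp_norm p_gt_1) auto
    finally have 1: "(\<integral>\<^sup>+ t. ?\<Psi> k (coord_upd x ?c t) \<partial>lborel)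
      \<le> ennreal ?w * epowr ?I (p $ ?c - 1) * mixed_I p v (Suc k) x"
      by (simp add: mult.assoc)
    have 2: "ennreal ?w * epowr ?I (p $ ?c - 1)
        \<le> ennreal (unit_cube k x * F_weight p u (Suc k) x) * epowr ?I (ext_exp p (Suc (Suc k)) - 1)"
    proof (cases ?I)
      case top
      then have "?w = 0" by (simp add: F_weight_Suc[OF k])
      then show ?thesis by (simp only: ennreal_0 mult_zero_left zero_le)
    next
      case (real a)
      let ?e = "ext_exp p (Suc (Suc k))"
      have "a powr (?e - p $ ?c) * a powr (p $ ?c - 1) = a powr (?e - 1)"
        by (simp add: powr_add[symmetric])
      then have "?w * a powr (p $ ?c - 1) = unit_cube k x * F_weight p u (Suc k) x * a powr (?e - 1)"
        using real by (simp add: F_weight_Suc[OF k] ext_exp_Suc[OF k] mult_ac)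
      then have "ennreal (?w * a powr (p $ ?c - 1)) = ennreal (unit_cube k x * F_weight p u (Suc k) x * a powr (?e - 1))"
        by (simp only:)
      then show ?thesis
        using real by (simp add: epowr_ennreal ennreal_mult'')
    qed
    have "indicator {0..1} (x $ ?c) * (\<integral>\<^sup>+ t. ?\<Psi> k (coord_upd x ?c t) \<partial>lborel)
      \<le> indicator {0..1} (x $ ?c) * (ennreal (unit_cube k x * F_weight p u (Suc k) x)
          * epowr ?I (ext_exp p (Suc (Suc k)) - 1) * mixed_I p v (Suc k) x)"
      by (intro mult_left_mono order_trans[OF 1] mult_right_mono 2) auto
    also have "\<dots> = ?\<Psi> (Suc k) x"
      by (simp add: unit_cube_Suc mult.assoc ennreal_mult' unit_cube_nonneg F_weight_nonneg split: split_indicator)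
    finally show "indicator {0..1} (x $ ?c) * (\<integral>\<^sup>+ t. ?\<Psi> k (coord_upd x ?c t) \<partial>lborel) \<le> ?\<Psi> (Suc k) x" .
  qed
  finally show ?thesis .
qed

text \<open>
  Iterating the previous step from \<open>0\<close> to \<open>n\<close> bounds \<open>\<integral> \<bar>\<F>\<^sub>p(u) v\<bar>\<close> by a finite constant times
  \<open>\<parallel>v\<parallel>\<^sub>p\<close>.
\<close>

lemma integrable_F_op:
  assumes [measurable]: "u \<in> borel_measurable borel" "v \<in> borel_measurable borel"
    and fin: "mixed_norm p u < top" "mixed_norm p v < top"
  shows "integrable lborel (\<lambda>x. F_op p u x * v x)"
proof -
  let ?\<Psi> = "\<lambda>k x. ennreal (unit_cube k x * F_weight p u k x)
        * (epowr (mixed_I p u k x) (ext_exp p (Suc k) - 1) * mixed_I p v k x)"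
  have "(\<integral>\<^sup>+ x. ?\<Psi> 0 x \<partial>lborel) \<le> (\<integral>\<^sup>+ x. ?\<Psi> k x \<partial>lborel)" if "k \<le> CARD('n)" for k
    using that
  proof (induction k)
    case (Suc k)
    then show ?case using nn_integral_F_step[of u v k] by (auto intro: order_trans)
  qed simp
  from this[of "CARD('n)"]
  have "(\<integral>\<^sup>+ x. ?\<Psi> 0 x \<partial>lborel) \<le> (\<integral>\<^sup>+ x. ?\<Psi> CARD('n) x \<partial>lborel)" by simp
  also have "\<dots> = epowr (mixed_norm p u) (ext_exp p (Suc CARD('n)) - 1) * mixed_norm p v"
    by (simp add: F_weight_CARD mixed_I_CARD nn_integral_multc unit_cube_CARD)
  also have "\<dots> < top" using fin by (simp add: ennreal_mult_less_top)
  finally have fin0: "(\<integral>\<^sup>+ x. ?\<Psi> 0 x \<partial>lborel) < top" .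
  have "ennreal (norm (F_op p u x * v x)) \<le> ?\<Psi> 0 x" for x
  proof -
    let ?m = "F_weight p u 0 x * \<bar>u x\<bar> powr (ext_exp p 1 - 1)"
    have "norm (F_op p u x * v x) = ?m * (\<bar>sgn (u x)\<bar> * \<bar>v x\<bar>)"
      unfolding F_op_eq by (simp add: abs_mult F_weight_nonneg)
    also have "\<dots> \<le> ?m * \<bar>v x\<bar>"
      by (intro mult_left_mono mult_nonneg_nonneg F_weight_nonneg) (auto simp: sgn_if)
    also have "ennreal (?m * \<bar>v x\<bar>) = ?\<Psi> 0 x"
      by (simp add: unit_cube_def epowr_ennreal ennreal_mult F_weight_nonneg mult.assoc)
    finally show ?thesis by (simp only: ennreal_leI)
  qed
  then have "(\<integral>\<^sup>+ x. ennreal (norm (F_op p u x * v x)) \<partial>lborel) < top"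
    by (intro le_less_trans[OF nn_integral_mono fin0])
  moreover have "(\<lambda>x. F_op p u x * v x) \<in> borel_measurable lborel"
    unfolding measurable_lborel2 by (rule measurable_F_op_mult) fact+
  ultimately show ?thesis unfolding integrable_iff_bounded infinity_ennreal_def by blast
qed

text \<open>
  The same telescoping of exponents, now as an equality: integrating \<open>\<F>\<^sub>p(u) v\<close> over the first \<open>k\<close>
  variables leaves the remaining weight times \<open>I\<^sub>k(u)\<close> to the power \<open>p\<^sub>k\<^sub>+\<^sub>1 - 1\<close> times the derivative
  at level \<open>k\<close>.  For \<open>k = n\<close> the exponent is \<open>p\<^sub>n\<^sub>+\<^sub>1 - 1 = 0\<close>.
\<close>

theorem integral_F_op:
  assumes [measurable]: "u \<in> borel_measurable borel" "v \<in> borel_measurable borel"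
    and fin: "mixed_norm p u < top" "mixed_norm p v < top" and nz: "mixed_norm p u \<noteq> 0"
  shows "(LINT x|lborel. F_op p u x * v x) = mixed_dI p u v CARD('n) 0"
proof -
  define \<Phi> where "\<Phi> k x = unit_cube k x * F_weight p u k x
        * (enn2real (mixed_I p u k x) powr (ext_exp p (Suc k) - 1) * mixed_dI p u v k x)" for k and x :: "'n rn"
  have step: "indicator {0..1} (x $ coord (Suc k)) * (LINT t|lborel. \<Phi> k (coord_upd x (coord (Suc k)) t)) = \<Phi> (Suc k) x"
    if k: "k < CARD('n)" for k x
  proof -
    let ?c = "coord (Suc k)" and ?a = "enn2real (mixed_I p u (Suc k) x)" and ?e = "ext_exp p (Suc (Suc k))"
    define L where "L = (LINT t|lborel. enn2real (mixed_I p u k (coord_upd x ?c t)) powr (p $ ?c - 1) * mixed_dI p u v k (coord_upd x ?c t))"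
    have slice: "(LINT t|lborel. \<Phi> k (coord_upd x ?c t))
        = unit_cube k x * (?a powr (?e - p $ ?c) * F_weight p u (Suc k) x) * L"
      unfolding \<Phi>_def unit_cube_coord_upd[OF k] F_weight_coord_upd ext_exp_Suc[OF k] L_def F_weight_Suc[OF k, symmetric, unfolded ext_exp_Suc[OF k]]
      by (rule integral_mult_right_zero)
    have "?a powr (?e - p $ ?c) = ?a powr (?e - 1) / ?a powr (p $ ?c - 1)"
      by (subst powr_diff[symmetric]) simp
    then have exponents: "?a powr (?e - p $ ?c) * L = ?a powr (?e - 1) * (L / ?a powr (p $ ?c - 1))"
      by simp
    have regroup: "i * (U * (A * W) * L) = (i * U) * W * (A * L)" for i U A W :: real
      by (simp add: mult_ac)
    show ?thesis
      unfolding slice unfolding \<Phi>_def unit_cube_Suc mixed_dI.simps(2) L_def[symmetric] regroup exponents ..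
  qed
  have chain: "integrable lborel (\<Phi> k) \<and> (LINT x|lborel. \<Phi> k x) = (LINT x|lborel. F_op p u x * v x)"
    if "k \<le> CARD('n)" for k
    using that
  proof (induction k)
    case 0
    have "\<Phi> 0 = (\<lambda>x. F_op p u x * v x)"
    proof
      fix x
      show "\<Phi> 0 x = F_op p u x * v x"
        unfolding F_op_eq \<Phi>_def by (simp add: unit_cube_def)
    qed
    then show ?case using integrable_F_op[OF assms(1-4)] by simp
  next
    case (Suc k)
    then have int: "integrable lborel (\<Phi> k)" and "k < CARD('n)" by auto
    from integral_slice_unit[OF int, of "coord (Suc k)"] Suc show ?case
      by (simp add: step[OF \<open>k < CARD('n)\<close>])
  qed
  have norm_pos: "enn2real (mixed_norm p u) \<noteq> 0"
    using nz fin(1) by (auto simp: enn2real_eq_0_iff)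
  have "\<Phi> CARD('n) x = mixed_dI p u v CARD('n) 0 * unit_cube CARD('n) x" for x
    using norm_pos
    by (simp add: \<Phi>_def F_weight_CARD mixed_I_CARD ext_exp_def mixed_dI_CARD[of p u v x 0] mult.commute)
  then show ?thesis
    using chain[of "CARD('n)"] by (simp add: unit_cube_CARD)
qed

end

section \<open>The derivative of the Gagliardo seminorms\<close>

text \<open>
  The difference quotient scaled so that its \<open>p\<close>-th power is the Gagliardo integrand with respect to
  Lebesgue measure \<open>dx dh\<close>; the seminorm becomes an ordinary \<open>L\<^sup>p\<close> norm on \<open>\<real>\<^sup>n \<times> \<real>\<close>.
\<close>

definition weighted_diff :: "real \<Rightarrow> real \<Rightarrow> 'n::finite \<Rightarrow> ('n rn \<Rightarrow> real) \<Rightarrow> 'n rn \<times> real \<Rightarrow> real" where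
  "weighted_diff s p i u z =
     (u (fst z + snd z *\<^sub>R axis i 1) - u (fst z)) / \<bar>snd z\<bar> powr ((1 + s * p) / p)"

lemma measurable_weighted_diff [measurable]:
  fixes u :: "'n::finite rn \<Rightarrow> real"
  assumes [measurable]: "u \<in> borel_measurable borel"
  shows "weighted_diff s p i u \<in> borel_measurable (lborel \<Otimes>\<^sub>M lborel)"
  unfolding weighted_diff_def by measurable

lemma weighted_diff_add: "weighted_diff s p i (\<lambda>x. u x + t * v x) z = weighted_diff s p i u z + t * weighted_diff s p i v z"
  by (simp add: weighted_diff_def add_divide_distrib[symmetric] algebra_simps)

lemma gagliardo_eq_Lp_norm:
  fixes u :: "'n::finite rn \<Rightarrow> real"
  assumes p: "1 < p" and [measurable]: "u \<in> borel_measurable borel"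
  shows "gagliardo s p i u = Lp_norm (lborel \<Otimes>\<^sub>M lborel) p (\<lambda>z. ennreal \<bar>weighted_diff s p i u z\<bar>)"
proof -
  have "\<bar>u (x + h *\<^sub>R axis i 1) - u x\<bar> powr p / \<bar>h\<bar> powr (1 + s * p) = \<bar>weighted_diff s p i u (x, h)\<bar> powr p" for x h
    using p by (simp add: weighted_diff_def powr_divide powr_powr abs_divide)
  then have "gagliardo s p i u = epowr (\<integral>\<^sup>+ x. \<integral>\<^sup>+ h. epowr (ennreal \<bar>weighted_diff s p i u (x, h)\<bar>) p \<partial>lborel \<partial>lborel) (1 / p)"
    by (simp add: gagliardo_def epowr_ennreal)
  also have "\<dots> = Lp_norm (lborel \<Otimes>\<^sub>M lborel) p (\<lambda>z. ennreal \<bar>weighted_diff s p i u z\<bar>)"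
    unfolding Lp_norm_def by (subst lborel.nn_integral_fst) measurable
  finally show ?thesis .
qed

lemma gagliardo_cmult:
  fixes u :: "'n::finite rn \<Rightarrow> real"
  assumes p: "1 < p" and [measurable]: "u \<in> borel_measurable borel"
  shows "gagliardo s p i (\<lambda>x. c * u x) = ennreal \<bar>c\<bar> * gagliardo s p i u"
proof -
  have "weighted_diff s p i (\<lambda>x. c * u x) z = c * weighted_diff s p i u z" for z
    by (simp add: weighted_diff_def right_diff_distrib)
  then show ?thesis
    using p by (simp add: gagliardo_eq_Lp_norm abs_mult ennreal_mult Lp_norm_cmult)
qed

lemma gagliardo_perturb_finite:
  fixes u :: "'n::finite rn \<Rightarrow> real"
  assumes p: "1 < p" and [measurable]: "u \<in> borel_measurable borel" "v \<in> borel_measurable borel"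
    and fin: "gagliardo s p i u < top" "gagliardo s p i v < top"
  shows "gagliardo s p i (\<lambda>x. u x + t * v x) < top"
proof -
  have "gagliardo s p i (\<lambda>x. u x + t * v x)
      \<le> Lp_norm (lborel \<Otimes>\<^sub>M lborel) p (\<lambda>z. ennreal \<bar>weighted_diff s p i u z\<bar> + ennreal \<bar>t\<bar> * ennreal \<bar>weighted_diff s p i v z\<bar>)"
    unfolding gagliardo_eq_Lp_norm[OF p, of "\<lambda>x. u x + t * v x", simplified] weighted_diff_add using p
    by (intro Lp_norm_mono) (auto simp: ennreal_mult[symmetric] ennreal_plus[symmetric] abs_mult[symmetric]
        intro!: ennreal_leI simp del: ennreal_plus)
  also have "\<dots> \<le> Lp_norm (lborel \<Otimes>\<^sub>M lborel) p (\<lambda>z. ennreal \<bar>weighted_diff s p i u z\<bar>)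
      + Lp_norm (lborel \<Otimes>\<^sub>M lborel) p (\<lambda>z. ennreal \<bar>t\<bar> * ennreal \<bar>weighted_diff s p i v z\<bar>)"
    by (intro Minkowski_Lp_norm p) measurable
  also have "\<dots> = gagliardo s p i u + ennreal \<bar>t\<bar> * gagliardo s p i v"
    using p by (simp add: gagliardo_eq_Lp_norm Lp_norm_cmult)
  also have "\<dots> < top" using fin by (simp add: ennreal_mult_less_top)
  finally show ?thesis .
qed

definition weak_form_summand :: "real \<Rightarrow> real \<Rightarrow> 'n::finite \<Rightarrow> ('n rn \<Rightarrow> real) \<Rightarrow> ('n rn \<Rightarrow> real) \<Rightarrow> real" where
  "weak_form_summand s p i u v = (LINT x|lborel. LINT h|lborel.
     (let d = diff_quot s i h u x / enn2real (gagliardo s p i u)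
      in \<bar>d\<bar> powr (p - 2) * d * diff_quot s i h v x / \<bar>h\<bar>))"

text \<open>
  The powers of \<open>\<bar>h\<bar>\<close> on the two sides agree: \<open>s (p - 1) + s + 1 = 1 + s p\<close>.
\<close>

lemma weak_form_summand_integrand:
  fixes u v :: "'n::finite rn \<Rightarrow> real"
  assumes p: "1 < p" and N: "0 < N"
  shows "(let d = diff_quot s i h u x / N in \<bar>d\<bar> powr (p - 2) * d * diff_quot s i h v x / \<bar>h\<bar>)
    = \<bar>weighted_diff s p i u (x, h)\<bar> powr (p - 1) * (sgn (weighted_diff s p i u (x, h)) * weighted_diff s p i v (x, h))
      / N powr (p - 1)"
proof (cases "h = 0")
  case True
  then show ?thesis by (simp add: diff_quot_def weighted_diff_def)
next
  case False
  define A where "A = u (x + h *\<^sub>R axis i 1) - u x"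
  define B where "B = v (x + h *\<^sub>R axis i 1) - v x"
  define r where "r = \<bar>h\<bar>"
  have r: "0 < r" using False by (simp add: r_def)
  have signed: "\<bar>d\<bar> powr (p - 2) * d = \<bar>d\<bar> powr (p - 1) * sgn d" for d :: real
    using powr_mult_base[of "\<bar>d\<bar>" "p - 2"] by (cases "d = 0") (auto simp: sgn_if mult.commute)
  have "\<bar>A / r powr s / N\<bar> powr (p - 1) * sgn (A / r powr s / N) * (B / r powr s) / r
      = \<bar>A\<bar> powr (p - 1) * sgn A * B / N powr (p - 1) / ((r powr s) powr (p - 1) * r powr s * r)"
    using r N by (simp add: abs_mult abs_divide powr_divide powr_mult sgn_divide)
  also have "(r powr s) powr (p - 1) * r powr s * r = r powr (1 + s * p)"
    using r by (simp add: powr_powr powr_add powr_diff right_diff_distrib)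
  also have "r powr (1 + s * p) = (r powr ((1 + s * p) / p)) powr (p - 1) * r powr ((1 + s * p) / p)"
  proof -
    have "(1 + s * p) / p * (p - 1) + (1 + s * p) / p = 1 + s * p"
      using p by (simp add: right_diff_distrib)
    then show ?thesis by (simp add: powr_powr powr_add[symmetric])
  qed
  also have "\<bar>A\<bar> powr (p - 1) * sgn A * B / N powr (p - 1)
        / ((r powr ((1 + s * p) / p)) powr (p - 1) * r powr ((1 + s * p) / p))
      = \<bar>A / r powr ((1 + s * p) / p)\<bar> powr (p - 1)
        * (sgn (A / r powr ((1 + s * p) / p)) * (B / r powr ((1 + s * p) / p))) / N powr (p - 1)"
    using r by (simp add: abs_divide powr_divide sgn_divide mult_ac)
  finally show ?thesis
    by (simp add: diff_quot_def weighted_diff_def A_def[symmetric] B_def[symmetric] r_def[symmetric] Let_def signed)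
qed

theorem gagliardo_has_derivative:
  fixes u v :: "'n::finite rn \<Rightarrow> real"
  assumes p: "1 < p" and meas [measurable]: "u \<in> borel_measurable borel" "v \<in> borel_measurable borel"
    and fin: "gagliardo s p i u < top" "gagliardo s p i v < top" and nz: "gagliardo s p i u \<noteq> 0"
  shows "((\<lambda>t. enn2real (gagliardo s p i (\<lambda>x. u x + t * v x))) has_real_derivative weak_form_summand s p i u v) (at 0)"
proof -
  let ?M = "lborel \<Otimes>\<^sub>M lborel :: ('n rn \<times> real) measure"
  let ?a = "weighted_diff s p i u" and ?b = "weighted_diff s p i v"
  let ?N = "enn2real (gagliardo s p i u)"
  have N: "0 < ?N" using nz fin(1) by (simp add: enn2real_positive_iff zero_less_iff_neq_zero)
  have eq: "gagliardo s p i (\<lambda>x. u x + t * v x) = Lp_norm ?M p (\<lambda>z. ennreal \<bar>?a z + t * ?b z\<bar>)" for t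
    using p by (simp add: gagliardo_eq_Lp_norm weighted_diff_add)
  have eq0: "gagliardo s p i u = Lp_norm ?M p (\<lambda>z. ennreal \<bar>?a z + 0 * ?b z\<bar>)"
    using p by (simp add: gagliardo_eq_Lp_norm)
  have "((\<lambda>t. enn2real (Lp_norm ?M p (\<lambda>z. ennreal \<bar>?a z + t * ?b z\<bar>))) has_real_derivative
      (LINT z|?M. \<bar>?a z + 0 * ?b z\<bar> powr (p - 1) * (sgn (?a z) * ?b z))
        / enn2real (Lp_norm ?M p (\<lambda>z. ennreal \<bar>?a z + 0 * ?b z\<bar>)) powr (p - 1)) (at 0)"
  proof (rule Lp_norm_has_derivative[OF p, where g = "\<lambda>z. \<bar>?b z\<bar>"])
    show "AE z in ?M. \<forall>t. \<bar>\<bar>?a z + t * ?b z\<bar> - \<bar>?a z + 0 * ?b z\<bar>\<bar> \<le> \<bar>t\<bar> * \<bar>?b z\<bar>"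
    proof (intro AE_I2 allI)
      fix z t
      show "\<bar>\<bar>?a z + t * ?b z\<bar> - \<bar>?a z + 0 * ?b z\<bar>\<bar> \<le> \<bar>t\<bar> * \<bar>?b z\<bar>"
        using abs_triangle_ineq3[of "?a z + t * ?b z" "?a z"] by (simp add: abs_mult)
    qed
    show "AE z in ?M. \<bar>?a z + 0 * ?b z\<bar> \<noteq> 0 \<longrightarrow>
        ((\<lambda>t. \<bar>?a z + t * ?b z\<bar>) has_real_derivative sgn (?a z) * ?b z) (at 0)"
      by (intro AE_I2 impI abs_has_derivative) auto
    show "Lp_norm ?M p (\<lambda>z. ennreal \<bar>?a z + 0 * ?b z\<bar>) < top" using fin(1) unfolding eq0 .
    show "Lp_norm ?M p (\<lambda>z. ennreal \<bar>?a z + 0 * ?b z\<bar>) \<noteq> 0" using nz unfolding eq0 .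
    show "Lp_norm ?M p (\<lambda>z. ennreal \<bar>?b z\<bar>) < top" using fin(2) p by (simp add: gagliardo_eq_Lp_norm)
  qed auto
  then have deriv: "((\<lambda>t. enn2real (gagliardo s p i (\<lambda>x. u x + t * v x))) has_real_derivative
      (LINT z|?M. \<bar>?a z\<bar> powr (p - 1) * (sgn (?a z) * ?b z)) / ?N powr (p - 1)) (at 0)"
    unfolding eq eq0[symmetric] by simp
  have "integrable ?M (\<lambda>z. \<bar>?a z\<bar> powr (p - 1) * (sgn (?a z) * ?b z))"
  proof (rule integrableI_bounded)
    have "(\<integral>\<^sup>+ z. ennreal (norm (\<bar>?a z\<bar> powr (p - 1) * (sgn (?a z) * ?b z))) \<partial>?M)
        \<le> (\<integral>\<^sup>+ z. epowr (ennreal \<bar>?a z\<bar>) (p - 1) * ennreal \<bar>?b z\<bar> \<partial>?M)"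
    proof (rule nn_integral_mono)
      fix z
      have "norm (\<bar>?a z\<bar> powr (p - 1) * (sgn (?a z) * ?b z)) \<le> \<bar>?a z\<bar> powr (p - 1) * \<bar>?b z\<bar>"
        by (auto simp: abs_mult sgn_if)
      then show "ennreal (norm (\<bar>?a z\<bar> powr (p - 1) * (sgn (?a z) * ?b z))) \<le> epowr (ennreal \<bar>?a z\<bar>) (p - 1) * ennreal \<bar>?b z\<bar>"
        by (simp add: epowr_ennreal ennreal_mult[symmetric] ennreal_leI)
    qed
    also have "\<dots> \<le> epowr (gagliardo s p i u) (p - 1) * gagliardo s p i v"
      unfolding gagliardo_eq_Lp_norm[OF p meas(1)] gagliardo_eq_Lp_norm[OF p meas(2)]
      by (intro Holder_Lp_norm p) measurable
    also have "\<dots> < \<infinity>" using fin by (simp add: ennreal_mult_less_top)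
    finally show "(\<integral>\<^sup>+ z. ennreal (norm (\<bar>?a z\<bar> powr (p - 1) * (sgn (?a z) * ?b z))) \<partial>?M) < \<infinity>" .
  qed measurable
  then have int: "integrable ?M (\<lambda>z. \<bar>?a z\<bar> powr (p - 1) * (sgn (?a z) * ?b z) / ?N powr (p - 1))"
    by (rule integrable_divide_zero) 
  have "weak_form_summand s p i u v = (LINT x|lborel. LINT h|lborel.
      \<bar>?a (x, h)\<bar> powr (p - 1) * (sgn (?a (x, h)) * ?b (x, h)) / ?N powr (p - 1))"
    unfolding weak_form_summand_def weak_form_summand_integrand[OF p N] ..
  also have "\<dots> = (LINT z|?M. \<bar>?a z\<bar> powr (p - 1) * (sgn (?a z) * ?b z) / ?N powr (p - 1))"
    by (rule lborel_pair.integral_fst'[OF int])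
  also have "\<dots> = (LINT z|?M. \<bar>?a z\<bar> powr (p - 1) * (sgn (?a z) * ?b z)) / ?N powr (p - 1)"
    by (rule integral_divide_zero)
  finally show ?thesis using deriv by simp
qed

section \<open>Nondegeneracy in \<open>W\<^sub>0\<close>\<close>

lemma AE_lborel_witness:
  assumes "AE h in lborel. P (h :: real)"
  shows "\<exists>h>c. P h"
proof (rule ccontr)
  assume "\<not> (\<exists>h>c. P h)"
  with assms have "AE h in lborel. \<not> h \<in> {c<..<c + 1}"
    by (auto elim!: eventually_mono)
  then have "emeasure lborel {h \<in> space lborel. h \<in> {c<..<c + 1}} = 0"
    by (rule emeasure_eq_0_AE)
  moreover have "{h \<in> space lborel. h \<in> {c<..<c + 1}} = {c<..<c + 1}" by auto
  ultimately show False by simp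
qed

text \<open>
  If \<open>[u]\<^bsub>s,p,i\<^esub> = 0\<close>, then \<open>u(x + h e\<^sub>i) = u(x)\<close> for almost all \<open>x\<close> and \<open>h\<close>; a large \<open>h\<close> moves \<open>x\<close> out of
  the bounded set, where \<open>u\<close> is \<open>0\<close>.  This makes the division by the seminorms in the weak equation
  legitimate.
\<close>

lemma gagliardo_eq_0_AE:
  fixes u :: "'n::finite rn \<Rightarrow> real"
  assumes p: "1 < p" and [measurable]: "u \<in> borel_measurable borel"
    and zero: "gagliardo s p i u = 0"
    and "bounded \<Omega>" and supp: "AE x in lborel. x \<notin> \<Omega> \<longrightarrow> u x = 0"
  shows "AE x in lborel. u x = 0"
proof -
  obtain R where R: "\<And>x. x \<in> \<Omega> \<Longrightarrow> norm x \<le> R" using \<open>bounded \<Omega>\<close> by (auto simp: bounded_iff)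
  have shift: "x + h *\<^sub>R axis i 1 = coord_upd x i (x $ i + h)" for x :: "'n rn" and h
    by (simp add: vec_eq_iff axis_def)
  have "AE z in lborel \<Otimes>\<^sub>M lborel. ennreal \<bar>weighted_diff s p i u z\<bar> = 0"
    using zero p by (intro Lp_norm_eq_0_AE) (auto simp: gagliardo_eq_Lp_norm)
  from lborel_pair.AE_pair[OF this]
  have "AE x in lborel. AE h in lborel. h \<noteq> 0 \<longrightarrow> u (x + h *\<^sub>R axis i 1) = u x"
    by (auto simp: weighted_diff_def elim!: eventually_mono)
  moreover have "AE x in lborel. AE t in lborel. coord_upd x i t \<notin> \<Omega> \<longrightarrow> u (coord_upd x i t) = 0"
    by (rule AE_slice[OF supp])
  ultimately show ?thesis
  proof eventually_elim
    case (elim x)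
    have "AE t in distr lborel borel ((+) (x $ i)). coord_upd x i t \<notin> \<Omega> \<longrightarrow> u (coord_upd x i t) = 0"
      using elim(2) by (simp only: lborel_distr_plus)
    then have "AE h in lborel. coord_upd x i (x $ i + h) \<notin> \<Omega> \<longrightarrow> u (coord_upd x i (x $ i + h)) = 0"
      by (rule AE_distrD[rotated]) simp
    with elim(1) have "AE h in lborel. (h \<noteq> 0 \<longrightarrow> u (x + h *\<^sub>R axis i 1) = u x)
        \<and> (x + h *\<^sub>R axis i 1 \<notin> \<Omega> \<longrightarrow> u (x + h *\<^sub>R axis i 1) = 0)"
      unfolding shift by eventually_elim auto
    from AE_lborel_witness[OF this, of "\<bar>x $ i\<bar> + \<bar>R\<bar>"] obtain h where h: "h > \<bar>x $ i\<bar> + \<bar>R\<bar>"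
      "h \<noteq> 0 \<longrightarrow> u (x + h *\<^sub>R axis i 1) = u x" "x + h *\<^sub>R axis i 1 \<notin> \<Omega> \<longrightarrow> u (x + h *\<^sub>R axis i 1) = 0"
      by blast
    have "x + h *\<^sub>R axis i 1 \<notin> \<Omega>"
    proof
      assume "x + h *\<^sub>R axis i 1 \<in> \<Omega>"
      then have "\<bar>(x + h *\<^sub>R axis i 1) $ i\<bar> \<le> R"
        using R component_le_norm_cart[of "x + h *\<^sub>R axis i 1" i] by (meson order_trans)
      then show False using h(1) by (simp add: axis_def)
    qed
    with h show ?case by auto
  qed
qed

lemma W0_space_D:
  assumes "u \<in> W0_space \<Omega> s p"
  shows "u \<in> borel_measurable borel" "mixed_norm p u < top" "gagliardo (s $ i) (p $ i) i u < top"
  using assms by (auto simp: W0_space_def W_space_def mixed_L_def infinity_ennreal_def)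

text \<open>
  Approximating test functions vanish outside \<open>\<Omega>\<close>, so the norm of \<open>u\<close> restricted to the complement is
  at most the norm of the error.
\<close>

lemma (in mixed_exponents) W0_space_vanishes_outside:
  assumes "open \<Omega>" and u: "u \<in> W0_space \<Omega> s p"
  shows "AE x in lborel. x \<notin> \<Omega> \<longrightarrow> u x = 0"
proof -
  define w where "w x = (if x \<in> \<Omega> then 0 else u x)" for x
  have [measurable]: "\<Omega> \<in> sets borel" "u \<in> borel_measurable borel"
    using \<open>open \<Omega>\<close> W0_space_D(1)[OF u] by auto
  have [measurable]: "w \<in> borel_measurable borel" unfolding w_def by measurable
  have "mixed_norm p w \<le> 0"
  proof (rule ennreal_le_epsilon)
    fix e :: real assume "0 < e"
    with u obtain f where f: "f \<in> Cc_infinity \<Omega>" "W_norm s p (\<lambda>x. u x - f x) < ennreal e"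
      unfolding W0_space_def by blast
    have "f x = 0" if "x \<notin> \<Omega>" for x
      using f(1) that closure_subset[of "{x. f x \<noteq> 0}"] by (auto simp: Cc_infinity_def)
    then have "mixed_norm p w \<le> mixed_norm p (\<lambda>x. u x - f x)"
      unfolding mixed_norm_def by (intro mixed_I_mono) (auto simp: w_def)
    also have "\<dots> \<le> W_norm s p (\<lambda>x. u x - f x)" by (simp add: W_norm_def)
    also have "\<dots> \<le> ennreal e" using f(2) by simp
    finally show "mixed_norm p w \<le> 0 + ennreal e" by simp
  qed
  then have "AE x in lborel. w x = 0" by (intro mixed_norm_eq_0_AE) auto
  then show ?thesis by eventually_elim (auto simp: w_def split: if_splits)
qed

section \<open>Critical points of the quotient\<close>

theorem theorem3p8:
  fixes \<Omega> :: "'n::{finite,linorder} rn set"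
    and s p :: "'n rn"
    and u :: "'n rn \<Rightarrow> real"
  assumes "open \<Omega>" and "connected \<Omega>" and "\<Omega> \<noteq> {}" and "bounded \<Omega>"
    and "1 < p $ coord 1" and "mono (\<lambda>i. p $ i)"
    and "\<forall>i. 0 < s $ i \<and> s $ i < 1"
    and "hmean p < real CARD('n)"
    and "hmean (s * p) < real CARD('n)"
    and "p $ coord CARD('n) < crit_exp s p"
    and "u \<in> W0_space \<Omega> s p" and "\<not> (AE x in lborel. u x = 0)"
  shows "critical_point \<Omega> s p u \<longleftrightarrow> (\<exists>c::real. weak_solution \<Omega> s p c u)"
proof -
  have p1: "1 < p $ i" for i
    using \<open>1 < p $ coord 1\<close> monoD[OF \<open>mono (\<lambda>i. p $ i)\<close> coord_first_le[of i]] by linarith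
  interpret mixed_exponents p by standard (rule p1)
  note u = \<open>u \<in> W0_space \<Omega> s p\<close>
  note uD = W0_space_D[OF u]
  define S where "S = enn2real (gagliardo_sum s p u)"
  define M where "M = enn2real (mixed_norm p u)"
  define dS where "dS v = (\<Sum>i\<in>UNIV. weak_form_summand (s $ i) (p $ i) i u v)" for v
  define dM where "dM v = (LINT x|lborel. F_op p u x * v x)" for v
  have norm_nz: "mixed_norm p u \<noteq> 0"
    using mixed_norm_eq_0_AE[OF uD(1)] assms(12) by blast
  then have M: "M > 0"
    using uD(2) by (simp add: M_def enn2real_positive_iff zero_less_iff_neq_zero)
  have gag_nz: "gagliardo (s $ i) (p $ i) i u \<noteq> 0" for i
    using gagliardo_eq_0_AE[OF p1 uD(1) _ \<open>bounded \<Omega>\<close> W0_space_vanishes_outside[OF \<open>open \<Omega>\<close> u]] assms(12) by blast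
  have S_sum: "enn2real (gagliardo_sum s p (\<lambda>x. u x + t * v x))
      = (\<Sum>i\<in>UNIV. enn2real (gagliardo (s $ i) (p $ i) i (\<lambda>x. u x + t * v x)))"
    if v: "v \<in> W0_space \<Omega> s p" for v t
    unfolding gagliardo_sum_def
    by (subst enn2real_sum) (auto intro!: gagliardo_perturb_finite p1 uD W0_space_D[OF v])
  have deriv_S: "((\<lambda>t. enn2real (gagliardo_sum s p (\<lambda>x. u x + t * v x))) has_real_derivative dS v) (at 0)"
    if v: "v \<in> W0_space \<Omega> s p" for v
    unfolding S_sum[OF v] dS_def
    by (intro DERIV_sum gagliardo_has_derivative p1 uD W0_space_D[OF v] gag_nz)
  have deriv_M: "((\<lambda>t. enn2real (mixed_norm p (\<lambda>x. u x + t * v x))) has_real_derivative dM v) (at 0)"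
    if v: "v \<in> W0_space \<Omega> s p" for v
    unfolding dM_def integral_F_op[OF uD(1) W0_space_D(1)[OF v] uD(2) W0_space_D(2)[OF v] norm_nz]
    by (intro mixed_norm_has_derivative uD W0_space_D[OF v] norm_nz)
  have deriv_Q: "((\<lambda>t. quotient_Q s p (\<lambda>x. u x + t * v x)) has_real_derivative (dS v * M - S * dM v) / (M * M)) (at 0)"
    if v: "v \<in> W0_space \<Omega> s p" for v
    unfolding quotient_Q_def using DERIV_divide[OF deriv_S[OF v] deriv_M[OF v]] M
    by (simp add: S_def M_def)
  have critical: "critical_point \<Omega> s p u \<longleftrightarrow> (\<forall>v\<in>W0_space \<Omega> s p. dS v * M = S * dM v)"
  proof -
    have "((\<lambda>t. quotient_Q s p (\<lambda>x. u x + t * v x)) has_real_derivative 0) (at 0) \<longleftrightarrow> dS v * M = S * dM v"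
      if v: "v \<in> W0_space \<Omega> s p" for v
    proof
      assume "((\<lambda>t. quotient_Q s p (\<lambda>x. u x + t * v x)) has_real_derivative 0) (at 0)"
      from DERIV_unique[OF this deriv_Q[OF v]] M show "dS v * M = S * dM v" by simp
    qed (use deriv_Q[OF v] in simp)
    then show ?thesis using assms(11,12) by (simp add: critical_point_def)
  qed
  have weak: "weak_solution \<Omega> s p c u \<longleftrightarrow> (\<forall>v\<in>W0_space \<Omega> s p. dS v = c * dM v)" for c
    using u by (simp add: weak_solution_def dS_def dM_def weak_form_summand_def)
  have hom: "((\<lambda>t. \<bar>1 + t * 1\<bar> * K) has_real_derivative K) (at 0)" for K :: real
    using DERIV_cmult_right[OF abs_has_derivative[of 1 1], of K] by simp
  have scaled: "(\<lambda>x. u x + t * u x) = (\<lambda>x. (1 + t * 1) * u x)" for t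
    by (simp add: algebra_simps)
  have "dS u = S"
  proof (rule DERIV_unique[OF deriv_S[OF u]])
    have "enn2real (gagliardo_sum s p (\<lambda>x. u x + t * u x)) = \<bar>1 + t * 1\<bar> * S" for t
      unfolding scaled S_def gagliardo_sum_def gagliardo_cmult[OF p1 uD(1)]
      by (simp only: sum_distrib_left[symmetric] enn2real_mult enn2real_ennreal abs_ge_zero)
    then show "((\<lambda>t. enn2real (gagliardo_sum s p (\<lambda>x. u x + t * u x))) has_real_derivative S) (at 0)"
      using hom[of S] by simp
  qed
  moreover have "dM u = M"
  proof (rule DERIV_unique[OF deriv_M[OF u]])
    have "enn2real (mixed_norm p (\<lambda>x. u x + t * u x)) = \<bar>1 + t * 1\<bar> * M" for t
      unfolding scaled M_def mixed_norm_def mixed_I_cmult[OF uD(1)]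
      by (simp only: enn2real_mult enn2real_ennreal abs_ge_zero)
    then show "((\<lambda>t. enn2real (mixed_norm p (\<lambda>x. u x + t * u x))) has_real_derivative M) (at 0)"
      using hom[of M] by simp
  qed
  ultimately have multiplier: "c = S / M" if "\<forall>v\<in>W0_space \<Omega> s p. dS v = c * dM v" for c
    using that u M by (simp add: field_simps)
  show ?thesis
  proof
    assume "critical_point \<Omega> s p u"
    then have "\<forall>v\<in>W0_space \<Omega> s p. dS v = S / M * dM v"
      using M by (simp add: critical field_simps)
    then show "\<exists>c. weak_solution \<Omega> s p c u" unfolding weak by blast
  next
    assume "\<exists>c. weak_solution \<Omega> s p c u"
    then obtain c where c: "\<forall>v\<in>W0_space \<Omega> s p. dS v = c * dM v" by (auto simp: weak)
    from multiplier[OF c] have "\<forall>v\<in>W0_space \<Omega> s p. dS v = S / M * dM v" using c by blast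
    then show "critical_point \<Omega> s p u" using M by (simp add: critical)
  qed
qed

end
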